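(* Let $N,n\ge 1$, let $c,\eta\in\mathbb C$ with $c\neq 0$, and consider canonical coordinates $p^a_i,q^a_i$ ($i=1,\dots,N$, $a=1,\dots,n$) with $\{p^a_i,q^b_j\}=\delta^{ab}\delta_{ij}$, $\{p^a_i,p^b_j\}=\{q^a_i,q^b_j\}=0$; the upper (site) indices are taken modulo $n$, so $q^0_i=q^n_i$, $p^0_i=p^n_i$, $q^{n+1}_i=q^1_i$, $p^{n+1}_i=p^1_i$. For $a=1,\dots,n$ define $N\times N$ matrices $$L^a_{ij}(z)=\phi(z,q^{a-1}_i-q^a_j+\eta)\,\frac{\prod_{l=1}^N\vartheta(q^a_j-q^{a-1}_l-\eta)}{\vartheta(-\eta)\prod_{l\neq j}\vartheta(q^a_j-q^a_l)}\,e^{p^a_j/c}.$$ Define $$r^a_{12}(z,w)=\sum_{i\neq j}\phi(z-w,q^a_i-q^a_j)E_{ij}\otimes E_{ji}+E_1(z-w)\sum_i E_{ii}\otimes E_{ii}-\sum_{i\neq j}E_1(q^a_i-q^a_j)E_{ii}\otimes E_{jj},$$ $$u^{+,a}_{12}=\sum_{i,j}E_1(q^{a-1}_j-q^a_i+\eta)E_{ii}\otimes E_{jj},\qquad u^{-,a}_{12}=-\sum_{i,j}E_1(q^{a-1}_i-q^a_j+\eta)E_{ii}\otimes E_{jj},$$ and with $D^a_{ij}(z)=L^a_{ij}(z)\big(E_1(z+q^{a-1}_i-q^a_j+\eta)-E_1(q^{a-1}_i-q^a_j+\eta)\big)$, $$s^a_{12}(z)=\sum_{i,j,m}(L^a(z)^{-1})_{mi}D^a_{ij}(z)E_{mj}\otimes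 E_{ii},\qquad s^a_{21}(w)=\sum_{i,j,m}(L^a(w)^{-1})_{mi}D^a_{ij}(w)E_{ii}\otimes E_{mj},$$ $s^{+,a}_{12}(z)=s^a_{12}(z)+u^{+,a}_{12}$, $s^{-,a}_{12}(w)=s^a_{21}(w)-u^{-,a}_{12}$. Then for all $a,b\in\{1,\dots,n\}$, identically in $z,w$, $$c\{L^a_1(z),L^b_2(w)\}=\delta^{ab}\Big(L^b_1(z)L^b_2(w)r^b_{12}(z,w)-r^{b-1}_{12}(z,w)L^b_1(z)L^b_2(w)+L^b_1(z)s^{+,b}_{12}(z)L^b_2(w)-L^b_2(w)s^{-,b}_{12}(w)L^b_1(z)\Big)$$ $$+\delta^{a,b-1}L^{b-1}_1(z)L^b_2(w)s^{-,b}_{12}(w)-\delta^{a,b+1}L^{b+1}_1(z)L^b_2(w)s^{+,b+1}_{12}(z),$$ where the Kronecker symbols $\delta^{a,b\pm1}$ and the indices $b\pm1$ are understood modulo $n$.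
   Context: $\vartheta(z)=-\sum_{j\in\mathbb Z}\exp\big(\pi\imath(j+\tfrac12)^2\tau+2\pi\imath(j+\tfrac12)(z+\tfrac12)\big)$ is the odd Jacobi theta function with $\mathrm{Im}\,\tau>0$; $\phi(z,u)=\frac{\vartheta'(0)\vartheta(z+u)}{\vartheta(z)\vartheta(u)}$; $E_1(u)=\vartheta'(u)/\vartheta(u)$. $E_{ij}$ are $N\times N$ matrix units; $L_1=L\otimes 1_N$, $L_2=1_N\otimes L$, $\{A_1(z),B_2(w)\}=\sum_{i,j,k,l}E_{ij}\otimes E_{kl}\{A_{ij}(z),B_{kl}(w)\}$. The Poisson bracket is $\{f,g\}=\sum_{a,i}(\partial_{p^a_i}f\,\partial_{q^a_i}g-\partial_{q^a_i}f\,\partial_{p^a_i}g)$. All quantities are taken at generic values so that they are defined (in particular $L^a(z)$ invertible). *)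

theory Defs
  imports "HOL-Analysis.Analysis"
begin

definition jtheta :: "complex \<Rightarrow> complex \<Rightarrow> complex" where
  "jtheta tau z = - infsum (\<lambda>j::int. exp (of_real pi * \<i> * (of_int j + 1/2)^2 * tau
        + 2 * of_real pi * \<i> * (of_int j + 1/2) * (z + 1/2))) UNIV"

definition ellphi :: "complex \<Rightarrow> complex \<Rightarrow> complex \<Rightarrow> complex" where
  "ellphi tau z u = deriv (jtheta tau) 0 * jtheta tau (z + u) / (jtheta tau z * jtheta tau u)"

definition E1 :: "complex \<Rightarrow> complex \<Rightarrow> complex" where
  "E1 tau u = deriv (jtheta tau) u / jtheta tau u"

definition cprev :: "nat \<Rightarrow> nat \<Rightarrow> nat" where
  "cprev n a = (if a = 1 then n else a - 1)"

definition cnext :: "nat \<Rightarrow> nat \<Rightarrow> nat" where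
  "cnext n a = (if a = n then 1 else a + 1)"

text \<open>Phase-space coordinates: p a i, q a i for sites a in 1..n and particle indices
  i in the finite type 'N (of cardinality N).\<close>

type_synonym 'N coords = "nat \<Rightarrow> 'N \<Rightarrow> complex"

definition dq :: "nat \<Rightarrow> 'N \<Rightarrow> ('N coords \<Rightarrow> 'N coords \<Rightarrow> complex) \<Rightarrow> 'N coords \<Rightarrow> 'N coords \<Rightarrow> complex" where
  "dq a i f p q = deriv (\<lambda>x. f p (q(a := (q a)(i := x)))) (q a i)"

definition dp :: "nat \<Rightarrow> 'N \<Rightarrow> ('N coords \<Rightarrow> 'N coords \<Rightarrow> complex) \<Rightarrow> 'N coords \<Rightarrow> 'N coords \<Rightarrow> complex" where
  "dp a i f p q = deriv (\<lambda>x. f (p(a := (p a)(i := x))) q) (p a i)"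

definition pb :: "nat \<Rightarrow> ('N::finite coords \<Rightarrow> 'N coords \<Rightarrow> complex) \<Rightarrow> ('N coords \<Rightarrow> 'N coords \<Rightarrow> complex)
     \<Rightarrow> 'N coords \<Rightarrow> 'N coords \<Rightarrow> complex" where
  "pb n f g p q = (\<Sum>a\<in>{1..n}. \<Sum>i\<in>UNIV. dp a i f p q * dq a i g p q - dq a i f p q * dp a i g p q)"

definition munit :: "'N::finite \<Rightarrow> 'N \<Rightarrow> complex^'N^'N" where
  "munit i j = (\<chi> r s. if r = i \<and> s = j then 1 else 0)"

definition tens :: "complex^'N^'N \<Rightarrow> complex^'N^'N \<Rightarrow> complex^('N \<times> 'N)^('N \<times> 'N)" where
  "tens A B = (\<chi> x y. A $ fst x $ fst y * B $ snd x $ snd y)"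

definition smat :: "complex \<Rightarrow> complex^'m^'n \<Rightarrow> complex^'m^'n" where
  "smat c M = (\<chi> x y. c * M $ x $ y)"

definition pbm :: "nat \<Rightarrow> ('N::finite coords \<Rightarrow> 'N coords \<Rightarrow> complex^'N^'N)
    \<Rightarrow> ('N coords \<Rightarrow> 'N coords \<Rightarrow> complex^'N^'N) \<Rightarrow> 'N coords \<Rightarrow> 'N coords
    \<Rightarrow> complex^('N \<times> 'N)^('N \<times> 'N)" where
  "pbm n A B p q = (\<chi> x y. pb n (\<lambda>p q. A p q $ fst x $ fst y) (\<lambda>p q. B p q $ snd x $ snd y) p q)"

definition Lmat :: "complex \<Rightarrow> complex \<Rightarrow> complex \<Rightarrow> nat \<Rightarrow> nat \<Rightarrow> complex
     \<Rightarrow> 'N::finite coords \<Rightarrow> 'N coords \<Rightarrow> complex^'N^'N" where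
  "Lmat tau eta c n a z p q = (\<chi> i j.
      ellphi tau z (q (cprev n a) i - q a j + eta)
      * (\<Prod>l\<in>UNIV. jtheta tau (q a j - q (cprev n a) l - eta))
      / (jtheta tau (- eta) * (\<Prod>l\<in>UNIV - {j}. jtheta tau (q a j - q a l)))
      * exp (p a j / c))"

definition L1 :: "complex \<Rightarrow> complex \<Rightarrow> complex \<Rightarrow> nat \<Rightarrow> nat \<Rightarrow> complex
     \<Rightarrow> 'N::finite coords \<Rightarrow> 'N coords \<Rightarrow> complex^('N \<times> 'N)^('N \<times> 'N)" where
  "L1 tau eta c n a z p q = tens (Lmat tau eta c n a z p q) (mat 1)"

definition L2 :: "complex \<Rightarrow> complex \<Rightarrow> complex \<Rightarrow> nat \<Rightarrow> nat \<Rightarrow> complex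
     \<Rightarrow> 'N::finite coords \<Rightarrow> 'N coords \<Rightarrow> complex^('N \<times> 'N)^('N \<times> 'N)" where
  "L2 tau eta c n a z p q = tens (mat 1) (Lmat tau eta c n a z p q)"

definition rmat :: "complex \<Rightarrow> nat \<Rightarrow> 'N::finite coords \<Rightarrow> complex \<Rightarrow> complex
     \<Rightarrow> complex^('N \<times> 'N)^('N \<times> 'N)" where
  "rmat tau a q z w =
     (\<Sum>i\<in>UNIV. \<Sum>j\<in>UNIV - {i}. smat (ellphi tau (z - w) (q a i - q a j)) (tens (munit i j) (munit j i)))
     + smat (E1 tau (z - w)) (\<Sum>i\<in>UNIV. tens (munit i i) (munit i i))
     - (\<Sum>i\<in>UNIV. \<Sum>j\<in>UNIV - {i}. smat (E1 tau (q a i - q a j)) (tens (munit i i) (munit j j)))"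

definition uplus :: "complex \<Rightarrow> complex \<Rightarrow> nat \<Rightarrow> nat \<Rightarrow> 'N::finite coords
     \<Rightarrow> complex^('N \<times> 'N)^('N \<times> 'N)" where
  "uplus tau eta n a q =
     (\<Sum>i\<in>UNIV. \<Sum>j\<in>UNIV. smat (E1 tau (q (cprev n a) j - q a i + eta)) (tens (munit i i) (munit j j)))"

definition uminus_mat :: "complex \<Rightarrow> complex \<Rightarrow> nat \<Rightarrow> nat \<Rightarrow> 'N::finite coords
     \<Rightarrow> complex^('N \<times> 'N)^('N \<times> 'N)" where
  "uminus_mat tau eta n a q =
     - (\<Sum>i\<in>UNIV. \<Sum>j\<in>UNIV. smat (E1 tau (q (cprev n a) i - q a j + eta)) (tens (munit i i) (munit j j)))"

definition Dmat :: "complex \<Rightarrow> complex \<Rightarrow> complex \<Rightarrow> nat \<Rightarrow> nat \<Rightarrow> complex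
     \<Rightarrow> 'N::finite coords \<Rightarrow> 'N coords \<Rightarrow> complex^'N^'N" where
  "Dmat tau eta c n a z p q = (\<chi> i j. Lmat tau eta c n a z p q $ i $ j
      * (E1 tau (z + q (cprev n a) i - q a j + eta) - E1 tau (q (cprev n a) i - q a j + eta)))"

definition s12 :: "complex \<Rightarrow> complex \<Rightarrow> complex \<Rightarrow> nat \<Rightarrow> nat \<Rightarrow> complex
     \<Rightarrow> 'N::finite coords \<Rightarrow> 'N coords \<Rightarrow> complex^('N \<times> 'N)^('N \<times> 'N)" where
  "s12 tau eta c n a z p q =
     (\<Sum>i\<in>UNIV. \<Sum>j\<in>UNIV. \<Sum>m\<in>UNIV.
        smat (matrix_inv (Lmat tau eta c n a z p q) $ m $ i * Dmat tau eta c n a z p q $ i $ j)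
             (tens (munit m j) (munit i i)))"

definition s21 :: "complex \<Rightarrow> complex \<Rightarrow> complex \<Rightarrow> nat \<Rightarrow> nat \<Rightarrow> complex
     \<Rightarrow> 'N::finite coords \<Rightarrow> 'N coords \<Rightarrow> complex^('N \<times> 'N)^('N \<times> 'N)" where
  "s21 tau eta c n a w p q =
     (\<Sum>i\<in>UNIV. \<Sum>j\<in>UNIV. \<Sum>m\<in>UNIV.
        smat (matrix_inv (Lmat tau eta c n a w p q) $ m $ i * Dmat tau eta c n a w p q $ i $ j)
             (tens (munit i i) (munit m j)))"

definition splus :: "complex \<Rightarrow> complex \<Rightarrow> complex \<Rightarrow> nat \<Rightarrow> nat \<Rightarrow> complex
     \<Rightarrow> 'N::finite coords \<Rightarrow> 'N coords \<Rightarrow> complex^('N \<times> 'N)^('N \<times> 'N)" where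
  "splus tau eta c n a z p q = s12 tau eta c n a z p q + uplus tau eta n a q"

definition sminus :: "complex \<Rightarrow> complex \<Rightarrow> complex \<Rightarrow> nat \<Rightarrow> nat \<Rightarrow> complex
     \<Rightarrow> 'N::finite coords \<Rightarrow> 'N coords \<Rightarrow> complex^('N \<times> 'N)^('N \<times> 'N)" where
  "sminus tau eta c n a w p q = s21 tau eta c n a w p q - uminus_mat tau eta n a q"

end

theory Submission
  imports Defs "HOL-Complex_Analysis.Cauchy_Integral_Formula"
begin

text \<open>Since \<open>L\<^sup>a\<close> depends only on \<open>p\<^sup>a\<close>, \<open>q\<^sup>a\<close>, \<open>q\<^sup>a\<^sup>-\<^sup>1\<close> and \<open>c \<partial>L\<^sup>a\<^sub>i\<^sub>j/\<partial>p\<^sup>a\<^sub>m = \<delta>\<^sub>j\<^sub>m L\<^sup>a\<^sub>i\<^sub>j\<close>, the component \<open>(ik, jl)\<close> of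
  \<open>c {L\<^sup>a\<^sub>1(z), L\<^sup>b\<^sub>2(w)}\<close> is \<open>L\<^sup>a\<^sub>i\<^sub>j(z) \<partial>L\<^sup>b\<^sub>k\<^sub>l(w)/\<partial>q\<^sup>a\<^sub>j - L\<^sup>b\<^sub>k\<^sub>l(w) \<partial>L\<^sup>a\<^sub>i\<^sub>j(z)/\<partial>q\<^sup>b\<^sub>l\<close>. Derivatives in the
  coordinates of the preceding site give exactly the terms with \<open>s\<^sup>\<plusminus>\<close>, because \<open>L\<close> cancels the inverse
  in \<open>s\<close>. For \<open>a = b\<close> one is left with an identity between the functions \<open>\<phi>\<close> and \<open>E\<^sub>1\<close>, which in the
  cases \<open>i \<noteq> k, j = l\<close> and \<open>i = k, j \<noteq> l\<close> is the addition formula for \<open>E\<^sub>1\<close>, and in the case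
  \<open>i \<noteq> k, j \<noteq> l\<close> is that formula combined with the three-term identity of the theta function.\<close>

section \<open>The odd theta function\<close>

lemma summable_on_exp_neg_abs_int: "(\<lambda>j::int. exp (- \<bar>real_of_int j\<bar>)) summable_on UNIV"
proof -
  have nat: "(\<lambda>k::nat. exp (- real k)) summable_on UNIV"
  proof (rule norm_summable_imp_summable_on)
    have "summable (\<lambda>k::nat. exp (-1 :: real) ^ k)"
      by (rule summable_geometric) simp
    thus "summable (\<lambda>k. norm (exp (- real k)))"
      by (simp add: exp_of_nat_mult[symmetric])
  qed
  have pos: "(\<lambda>j::int. exp (- \<bar>real_of_int j\<bar>)) summable_on {0..}"
    using nat
    by (subst summable_on_reindex_bij_witness[of "{0..}" int nat UNIV "\<lambda>k. exp (- real k)"]) auto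
  have neg: "(\<lambda>j::int. exp (- \<bar>real_of_int j\<bar>)) summable_on {..0}"
    using nat
    by (subst summable_on_reindex_bij_witness[of "{..0}" "\<lambda>k. - int k" "\<lambda>j. nat (- j)" UNIV "\<lambda>k. exp (- real k)"]) auto
  have "UNIV = {0..} \<union> {..(0::int)}"
    by auto
  thus ?thesis
    using summable_on_union[OF pos neg] by simp
qed

text \<open>Completing the square with \<open>B + 1\<close> in place of \<open>B\<close> bounds the
  exponent by a constant minus \<open>t\<close>, where \<open>t\<close> is the absolute value of
  \<open>j + s\<close>. The extra 1 leaves a geometric factor, and replacing \<open>t\<close> by the
  absolute value of \<open>j\<close> costs at most \<open>exp \<bar>s\<bar>\<close>.\<close>

lemma summable_on_gaussian_int:
  fixes A B s :: real
  assumes "A > 0"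
  shows "(\<lambda>j::int. exp (- A * (real_of_int j + s)\<^sup>2 + B * \<bar>real_of_int j + s\<bar>)) summable_on UNIV"
proof (rule summable_on_comparison_test)
  let ?C = "exp ((B + 1)\<^sup>2 / (4 * A) + \<bar>s\<bar>)"
  show "(\<lambda>j::int. ?C * exp (- \<bar>real_of_int j\<bar>)) summable_on UNIV"
    by (intro summable_on_cmult_right summable_on_exp_neg_abs_int)
  fix j :: int
  define t where "t = \<bar>real_of_int j + s\<bar>"
  have "0 \<le> (2 * A * t - (B + 1))\<^sup>2 / (4 * A)"
    using assms by simp
  also have "(2 * A * t - (B + 1))\<^sup>2 = 4 * A * (A * t\<^sup>2 - (B + 1) * t) + (B + 1)\<^sup>2"
    by algebra
  also have "\<dots> / (4 * A) = A * t\<^sup>2 - (B + 1) * t + (B + 1)\<^sup>2 / (4 * A)"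
    using assms by (simp add: add_divide_distrib)
  finally have "- A * t\<^sup>2 + B * t \<le> (B + 1)\<^sup>2 / (4 * A) - t"
    by (simp add: algebra_simps)
  moreover have "t \<ge> \<bar>real_of_int j\<bar> - \<bar>s\<bar>"
    unfolding t_def by linarith
  ultimately have "- A * t\<^sup>2 + B * t \<le> ((B + 1)\<^sup>2 / (4 * A) + \<bar>s\<bar>) + - \<bar>real_of_int j\<bar>"
    by linarith
  thus "exp (- A * (real_of_int j + s)\<^sup>2 + B * \<bar>real_of_int j + s\<bar>) \<le> ?C * exp (- \<bar>real_of_int j\<bar>)"
    unfolding exp_add[symmetric] exp_le_cancel_iff by (simp add: t_def)
qed auto

section \<open>Convergence, holomorphy and parity of the theta series\<close>

definition theta_term :: "complex \<Rightarrow> complex \<Rightarrow> int \<Rightarrow> complex" where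
  "theta_term tau z j = exp (of_real pi * \<i> * (of_int j + 1/2)^2 * tau
        + 2 * of_real pi * \<i> * (of_int j + 1/2) * (z + 1/2))"

lemma jtheta_eq: "jtheta tau z = - infsum (theta_term tau z) UNIV"
  unfolding jtheta_def by (simp add: theta_term_def[abs_def])

text \<open>The bound sees \<open>z\<close> only through \<open>R\<close>, so it is a single
  majorant for a whole horizontal strip, as the M-test requires.\<close>

lemma norm_theta_term_le:
  assumes "\<bar>Im z\<bar> \<le> R"
  shows "norm (theta_term tau z j)
    \<le> exp (- (pi * Im tau) * (real_of_int j + 1/2)\<^sup>2 + (2 * pi * R) * \<bar>real_of_int j + 1/2\<bar>)"
proof -
  define t where "t = real_of_int j + 1/2"
  have t: "of_int j + 1/2 = complex_of_real t"
    by (simp add: t_def)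
  have "norm (theta_term tau z j) = exp (- (pi * Im tau) * t\<^sup>2 + 2 * pi * (- (t * Im z)))"
    unfolding theta_term_def t norm_exp_eq_Re of_real_power[symmetric] by simp
  also have "- (t * Im z) \<le> R * \<bar>t\<bar>"
    using abs_ge_minus_self[of "t * Im z"] mult_right_mono[OF assms abs_ge_zero[of t]]
    by (simp only: abs_mult mult.commute[of "\<bar>t\<bar>"])
  then have "exp (- (pi * Im tau) * t\<^sup>2 + 2 * pi * (- (t * Im z)))
      \<le> exp (- (pi * Im tau) * t\<^sup>2 + 2 * pi * R * \<bar>t\<bar>)"
    unfolding exp_le_cancel_iff mult.assoc by (intro add_left_mono mult_left_mono) auto
  finally show ?thesis
    by (simp only: t_def)
qed

lemma summable_on_theta_term:
  assumes "Im tau > 0"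
  shows "theta_term tau z summable_on UNIV"
  using summable_on_gaussian_int[of "pi * Im tau" "1/2" "2 * pi * \<bar>Im z\<bar>"] assms
  by (intro abs_summable_summable[OF Infinite_Sum.abs_summable_on_comparison_test'[OF _ norm_theta_term_le]]) auto

lemma holomorphic_on_jtheta:
  assumes "Im tau > 0"
  shows "jtheta tau holomorphic_on UNIV"
proof -
  have "jtheta tau field_differentiable at z" for z
  proof -
    \<comment> \<open>\<open>R\<close> bounds the imaginary part on the closed unit disc about
      \<open>z\<close>. The finite partial sums are holomorphic, and their uniform limit on that
      disc is holomorphic inside.\<close>
    define R where "R = \<bar>Im z\<bar> + 1"
    have bound: "\<bar>Im y\<bar> \<le> R" if "y \<in> cball z 1" for y
      using that abs_Im_le_cmod[of "z - y"] by (auto simp: R_def dist_norm)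
    have "uniform_limit (cball z 1) (\<lambda>X y. \<Sum>j\<in>X. theta_term tau y j)
        (\<lambda>y. \<Sum>\<^sub>\<infinity>j. theta_term tau y j) (finite_subsets_at_top UNIV)"
      using summable_on_gaussian_int[of "pi * Im tau" "1/2" "2 * pi * R"] assms
      by (intro Weierstrass_m_test_general[OF norm_theta_term_le[OF bound]]) auto
    then have "(\<lambda>y. \<Sum>\<^sub>\<infinity>j. theta_term tau y j) holomorphic_on ball z 1"
      by (rule holomorphic_uniform_limit[rotated])
        (auto simp: theta_term_def intro!: always_eventually continuous_intros holomorphic_intros)
    then have "jtheta tau holomorphic_on ball z 1"
      unfolding jtheta_eq by (rule holomorphic_on_minus)
    thus ?thesis
      by (rule holomorphic_on_imp_differentiable_at) auto
  qed
  thus ?thesis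
    by (simp add: holomorphic_on_def)
qed

lemma has_field_derivative_jtheta:
  assumes "Im tau > 0"
  shows "(jtheta tau has_field_derivative deriv (jtheta tau) z) (at z)"
  using holomorphic_on_jtheta[OF assms] by (rule holomorphic_derivI) auto

lemma has_field_derivative_jtheta_chain [derivative_intros]:
  assumes "Im tau > 0" and "(g has_field_derivative g') (at x within S)"
  shows "((\<lambda>x. jtheta tau (g x)) has_field_derivative deriv (jtheta tau) (g x) * g') (at x within S)"
  using has_field_derivative_jtheta[OF assms(1)] assms(2) by (rule DERIV_chain2)

text \<open>The reindexing \<open>j\<close> to \<open>- 1 - j\<close> negates
  \<open>j + 1/2\<close>, which fixes the quadratic part of the exponent. The shift in
  \<open>z + 1/2\<close> then contributes the factor
  \<open>exp (- 2 pi i (j + 1/2)) = -1\<close>.\<close>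

lemma jtheta_minus: "jtheta tau (- z) = - jtheta tau z"
proof -
  have "theta_term tau (- z) (- 1 - j) = - theta_term tau z j" for j
  proof -
    have "theta_term tau (- z) (- 1 - j)
        = exp (of_real pi * \<i> * (of_int j + 1/2)^2 * tau
        + 2 * of_real pi * \<i> * (of_int j + 1/2) * (z + 1/2) + (- (2 * of_int (j + 1) * of_real pi * \<i>) + of_real pi * \<i>))"
      unfolding theta_term_def by (rule arg_cong[where f = exp]) (simp add: algebra_simps power2_eq_square)
    also have "\<dots> = theta_term tau z j * (exp (- (2 * of_int (j + 1) * of_real pi * \<i>)) * exp (of_real pi * \<i>))"
      by (simp only: exp_add theta_term_def)
    also have "exp (- (2 * of_int (j + 1) * of_real pi * \<i>)) = 1"
      using exp_integer_2pi[of "of_int (j + 1)"] by (simp add: exp_minus)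
    finally show ?thesis
      by simp
  qed
  then have "infsum (\<lambda>j. - theta_term tau z j) UNIV = infsum (theta_term tau (- z)) UNIV"
    by (intro infsum_reindex_bij_witness[of _ "\<lambda>j. - 1 - j" "\<lambda>j. - 1 - j"]) auto
  thus ?thesis
    by (simp add: jtheta_eq infsum_uminus)
qed

lemma jtheta_zero [simp]: "jtheta tau 0 = 0"
  using jtheta_minus[of tau 0] by simp

lemma deriv_jtheta_minus:
  assumes "Im tau > 0"
  shows "deriv (jtheta tau) (- z) = deriv (jtheta tau) z"
proof -
  have "((\<lambda>x. jtheta tau (- x)) has_field_derivative - deriv (jtheta tau) (- z)) (at z)"
    using assms by (auto intro!: derivative_eq_intros)
  moreover have "((\<lambda>x. jtheta tau (- x)) has_field_derivative - deriv (jtheta tau) z) (at z)"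
    unfolding jtheta_minus by (intro DERIV_minus has_field_derivative_jtheta assms)
  ultimately show ?thesis
    using DERIV_unique by fastforce
qed

lemma E1_minus:
  assumes "Im tau > 0"
  shows "E1 tau (- z) = - E1 tau z"
  using assms by (simp add: E1_def jtheta_minus deriv_jtheta_minus)

section \<open>Quadratic identities of the theta function\<close>

lemma has_sum_mult_Times:
  fixes f :: "'a \<Rightarrow> complex" and g :: "'b \<Rightarrow> complex"
  assumes f: "f summable_on A" and g: "g summable_on B"
  shows "((\<lambda>(x, y). f x * g y) has_sum infsum f A * infsum g B) (A \<times> B)"
proof (rule has_sum_SigmaI)
  show "((\<lambda>y. case (x, y) of (x, y) \<Rightarrow> f x * g y) has_sum f x * infsum g B) B" for x
    using g by (auto intro!: has_sum_cmult_right)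
  show "((\<lambda>x. f x * infsum g B) has_sum infsum f A * infsum g B) A"
    using f by (auto intro!: has_sum_cmult_left)
  \<comment> \<open>Complex summability is absolute summability, so both factors have summable norms
    and the iterated sums above give the sum over the product set.\<close>
  have "(\<lambda>p. norm (case p of (x, y) \<Rightarrow> f x * g y)) summable_on A \<times> B"
    using f g unfolding summable_on_iff_abs_summable_on_complex
    by (subst Infinite_Sum.abs_summable_on_Sigma_iff)
      (auto simp: norm_mult infsum_cmult_right' summable_on_cmult_right
        abs_mult intro!: summable_on_cmult_left)
  thus "(\<lambda>(x, y). f x * g y) summable_on A \<times> B"
    by (rule abs_summable_summable)
qed

text \<open>The even and odd parts of a theta series at modulus \<open>tau/2\<close>. The substitution \<open>r = j + k + 1\<close>,
  \<open>s = j - k\<close> in the double series turns \<open>jtheta (x + y) * jtheta (x - y)\<close> into the 2x2 determinant of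
  the vectors (even part, odd part) at \<open>x\<close> and \<open>y\<close>, so Weierstrass' identity is the Pluecker relation.\<close>

definition theta2_term :: "complex \<Rightarrow> complex \<Rightarrow> int \<Rightarrow> complex" where
  "theta2_term tau x r = exp (of_real pi * \<i> * of_int r ^ 2 * tau / 2 + 2 * of_real pi * \<i> * of_int r * x)"

definition theta_even :: "complex \<Rightarrow> complex \<Rightarrow> complex" where
  "theta_even tau x = infsum (theta2_term tau x) {r. even r}"

definition theta_odd :: "complex \<Rightarrow> complex \<Rightarrow> complex" where
  "theta_odd tau x = infsum (theta2_term tau x) {r. odd r}"

lemma summable_on_theta2_term:
  assumes "Im tau > 0"
  shows "theta2_term tau x summable_on S"
proof -
  have "norm (theta2_term tau x r)
      \<le> exp (- (pi * Im tau / 2) * (real_of_int r + 0)\<^sup>2 + (2 * pi * \<bar>Im x\<bar>) * \<bar>real_of_int r + 0\<bar>)" for r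
  proof -
    define t where "t = real_of_int r"
    have t: "of_int r = complex_of_real t"
      by (simp add: t_def)
    have "norm (theta2_term tau x r) = exp (- (pi * Im tau / 2) * t\<^sup>2 + 2 * pi * (- (t * Im x)))"
      unfolding theta2_term_def t norm_exp_eq_Re of_real_power[symmetric] by simp
    also have "- (t * Im x) \<le> \<bar>Im x\<bar> * \<bar>t\<bar>"
      using abs_ge_minus_self[of "t * Im x"] by (simp only: abs_mult mult.commute)
    then have "exp (- (pi * Im tau / 2) * t\<^sup>2 + 2 * pi * (- (t * Im x)))
        \<le> exp (- (pi * Im tau / 2) * t\<^sup>2 + 2 * pi * \<bar>Im x\<bar> * \<bar>t\<bar>)"
      unfolding exp_le_cancel_iff mult.assoc by (intro add_left_mono mult_left_mono) auto
    finally show ?thesis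
      by (simp only: t_def add_0_right)
  qed
  then have "(\<lambda>r. norm (theta2_term tau x r)) summable_on UNIV"
    using summable_on_gaussian_int[of "pi * Im tau / 2" 0 "2 * pi * \<bar>Im x\<bar>"] assms
    by (intro Infinite_Sum.abs_summable_on_comparison_test') auto
  thus ?thesis
    by (rule summable_on_subset_banach[OF abs_summable_summable]) auto
qed

text \<open>By the parallelogram law \<open>(j + 1/2)^2 + (k + 1/2)^2 = (r^2 + s^2) / 2\<close> with
  \<open>r = j + k + 1\<close> and \<open>s = j - k\<close>; hence the halved modulus. The two
  shifts by 1/2 together give \<open>exp (pi i r)\<close>, the sign.\<close>

lemma theta_term_mult:
  "theta_term tau (x + y) j * theta_term tau (x - y) k
    = (if even (j + k + 1) then 1 else - 1) * (theta2_term tau x (j + k + 1) * theta2_term tau y (j - k))"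
proof -
  have sgn: "exp (of_int r * (of_real pi * \<i>)) = (if even r then 1 else - 1)" for r
  proof (cases "even r")
    case True
    then obtain m where "r = 2 * m" by blast
    thus ?thesis
      using exp_integer_2pi[of "of_int m"] by (simp add: mult_ac)
  next
    case False
    then obtain m where m: "r = 2 * m + 1" by (blast elim: oddE)
    have "exp (of_int r * (of_real pi * \<i>)) = exp (2 * of_int m * of_real pi * \<i>) * exp (of_real pi * \<i>)"
      unfolding exp_add[symmetric] m by (simp add: algebra_simps)
    thus ?thesis
      using exp_integer_2pi[of "of_int m"] m by simp
  qed
  have exponent: "P * (J + 1/2)\<^sup>2 * tau + 2 * P * (J + 1/2) * (x + y + 1/2)
      + (P * (K + 1/2)\<^sup>2 * tau + 2 * P * (K + 1/2) * (x - y + 1/2))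
    = (J + K + 1) * P + (P * (J + K + 1)\<^sup>2 * tau / 2 + 2 * P * (J + K + 1) * x
      + (P * (J - K)\<^sup>2 * tau / 2 + 2 * P * (J - K) * y))" for P J K :: complex
    by (simp add: field_simps power2_eq_square)
  have "theta_term tau (x + y) j * theta_term tau (x - y) k
    = exp (of_int (j + k + 1) * (of_real pi * \<i>)) * (theta2_term tau x (j + k + 1) * theta2_term tau y (j - k))"
    unfolding theta_term_def theta2_term_def exp_add[symmetric]
    by (rule arg_cong[where f = exp])
      (use exponent[of "of_real pi * \<i>" "of_int j" "of_int k"] in
        \<open>simp only: of_int_add of_int_diff of_int_1 mult.assoc\<close>)
  thus ?thesis
    by (simp only: sgn)
qed

lemma jtheta_add_mult_diff:
  assumes tau: "Im tau > 0"
  shows "jtheta tau (x + y) * jtheta tau (x - y)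
    = theta_even tau x * theta_odd tau y - theta_odd tau x * theta_even tau y"
proof -
  let ?E = "{r::int. even r}" and ?O = "{r::int. odd r}"
  let ?h = "\<lambda>(r, s). (if even r then 1 else - 1) * (theta2_term tau x r * theta2_term tau y s)"
  have sx: "theta2_term tau x summable_on S" and sy: "theta2_term tau y summable_on S" for S
    using summable_on_theta2_term[OF tau] by blast+
  have "((\<lambda>(j, k). theta_term tau (x + y) j * theta_term tau (x - y) k)
      has_sum jtheta tau (x + y) * jtheta tau (x - y)) (UNIV \<times> UNIV)"
    using has_sum_mult_Times[OF summable_on_theta_term[OF tau] summable_on_theta_term[OF tau]]
    by (simp add: jtheta_eq)
  \<comment> \<open>Since \<open>r + s = 2 * j + 1\<close>, exactly the pairs of opposite parity
    occur, and on them both divisions by 2 in the inverse map are exact. The parity of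
    \<open>r\<close> fixes the sign on each of the two rectangles.\<close>
  also have "?this \<longleftrightarrow> (?h has_sum jtheta tau (x + y) * jtheta tau (x - y)) (?E \<times> ?O \<union> ?O \<times> ?E)"
  proof (rule has_sum_reindex_bij_witness[of _ "\<lambda>(r, s). ((r + s - 1) div 2, (r - s - 1) div 2)"
          "\<lambda>(j, k). (j + k + 1, j - k)"])
    fix b :: "int \<times> int"
    assume "b \<in> ?E \<times> ?O \<union> ?O \<times> ?E"
    then obtain r s where b: "b = (r, s)" and "odd (r + s)"
      by auto
    then obtain m where "r + s = 2 * m + 1"
      by (blast elim: oddE)
    then have "r + s - 1 = 2 * m" "r - s - 1 = 2 * (m - s)"
      by simp_all
    with \<open>r + s = 2 * m + 1\<close> show "(case case b of (r, s) \<Rightarrow> ((r + s - 1) div 2, (r - s - 1) div 2) of (j, k) \<Rightarrow> (j + k + 1, j - k)) = b"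
      by (simp only: b prod.case) simp
  qed (auto simp: theta_term_mult)
  finally have 1: "(?h has_sum jtheta tau (x + y) * jtheta tau (x - y)) (?E \<times> ?O \<union> ?O \<times> ?E)" .
  have "(?h has_sum theta_even tau x * theta_odd tau y) (?E \<times> ?O)"
    using has_sum_mult_Times[OF sx[of ?E] sy[of ?O]] unfolding theta_even_def theta_odd_def
    by (rule has_sum_cong[THEN iffD1, rotated]) auto
  moreover have "(?h has_sum - (theta_odd tau x * theta_even tau y)) (?O \<times> ?E)"
    using has_sum_uminusI[OF has_sum_mult_Times[OF sx[of ?O] sy[of ?E]]] unfolding theta_even_def theta_odd_def
    by (rule has_sum_cong[THEN iffD1, rotated]) auto
  ultimately have "(?h has_sum theta_even tau x * theta_odd tau y + - (theta_odd tau x * theta_even tau y))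
      (?E \<times> ?O \<union> ?O \<times> ?E)"
    by (rule has_sum_Un_disjoint) auto
  from has_sum_unique[OF 1 this] show ?thesis
    by simp
qed

lemma jtheta_weierstrass:
  assumes "Im tau > 0"
  shows "jtheta tau (x + y) * jtheta tau (x - y) * (jtheta tau (u + v) * jtheta tau (u - v))
    = jtheta tau (x + u) * jtheta tau (x - u) * (jtheta tau (y + v) * jtheta tau (y - v))
    - jtheta tau (x + v) * jtheta tau (x - v) * (jtheta tau (y + u) * jtheta tau (y - u))"
  unfolding jtheta_add_mult_diff[OF assms] by (simp add: algebra_simps)

text \<open>Weierstrass' identity in the variables in which it becomes a relation between values of
  the Kronecker function: \<open>z\<close>, \<open>w\<close> will be spectral parameters and
  \<open>A\<close>, \<open>B\<close>, \<open>C\<close> differences of coordinates.\<close>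

lemma jtheta_fay:
  assumes "Im tau > 0"
  shows "jtheta tau (z + A + C) * jtheta tau (w + B + C) * (jtheta tau (A + B) * jtheta tau (z - w))
    = jtheta tau (z - w + A) * jtheta tau (z + C) * jtheta tau (w + A + B + C) * jtheta tau B
    + jtheta tau (z - w - B) * jtheta tau (z + A + B + C) * jtheta tau (w + C) * jtheta tau A"
proof -
  \<comment> \<open>These solve \<open>x + y = z + A + C\<close>, \<open>x - y = w + B + C\<close>,
    \<open>u + v = A + B\<close>, \<open>u - v = z - w\<close>. Among the other eight arguments only
    \<open>y - u = - B\<close> appears with the wrong sign, and oddness turns the minus of
    Weierstrass' identity into a plus.\<close>
  define x y u v where "x = (z + w + A + B + 2 * C) / 2" and "y = (z - w + A - B) / 2"
    and "u = (A + B + z - w) / 2" and "v = (A + B - z + w) / 2"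
  note defs = x_def y_def u_def v_def
  have eqs: "x + y = z + A + C" "x - y = w + B + C" "u + v = A + B" "u - v = z - w"
    "x + u = z + A + B + C" "x - u = w + C" "y + v = A" "y - v = z - w - B"
    "x + v = w + A + B + C" "x - v = z + C" "y + u = z - w + A" "y - u = - B"
    by (simp_all add: defs field_simps)
  have "a * b * (c * d) = e * f * (g * h) - i * j * (k * - l) \<Longrightarrow> a * b * (c * d) = k * j * i * l + h * e * f * g"
    for a b c d e f g h i j k l :: complex
    by (simp add: algebra_simps)
  from this[OF jtheta_weierstrass[OF assms, of x y u v, unfolded eqs jtheta_minus]]
  show ?thesis .
qed

text \<open>The derivative of \<open>jtheta_fay\<close> in \<open>z\<close> at \<open>z = w = 0\<close>.\<close>

lemma E1_addition:
  assumes tau: "Im tau > 0"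
    and nz: "jtheta tau A \<noteq> 0" "jtheta tau B \<noteq> 0" "jtheta tau C \<noteq> 0" "jtheta tau (A + B + C) \<noteq> 0"
  shows "(E1 tau A + E1 tau B + E1 tau C - E1 tau (A + B + C))
      * (jtheta tau A * jtheta tau B * jtheta tau C * jtheta tau (A + B + C))
    = deriv (jtheta tau) 0 * jtheta tau (A + B) * jtheta tau (B + C) * jtheta tau (A + C)"
proof -
  let ?t = "jtheta tau" and ?d = "deriv (jtheta tau)"
  \<comment> \<open>The factor \<open>?t z\<close> vanishes at 0, so only its own derivative
    survives.\<close>
  have lhs: "((\<lambda>z. ?t (z + A + C) * ?t (B + C) * (?t (A + B) * ?t z))
      has_field_derivative ?t (A + C) * ?t (B + C) * (?t (A + B) * ?d 0)) (at 0)"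
    by (rule derivative_eq_intros tau refl)+ simp
  have eq: "(\<lambda>z. ?t (z + A + C) * ?t (B + C) * (?t (A + B) * ?t z))
     = (\<lambda>z. ?t (z + A) * ?t (z + C) * ?t (A + B + C) * ?t B
          + ?t (z - B) * ?t (z + A + B + C) * ?t C * ?t A)"
    using jtheta_fay[OF tau, of _ A C 0 B] by simp
  have "((\<lambda>z. ?t (z + A) * ?t (z + C) * ?t (A + B + C) * ?t B
          + ?t (z - B) * ?t (z + A + B + C) * ?t C * ?t A)
      has_field_derivative (?d A * ?t C + ?t A * ?d C) * ?t (A + B + C) * ?t B
        + (?d B * ?t (A + B + C) - ?t B * ?d (A + B + C)) * ?t C * ?t A) (at 0)"
    by (rule derivative_eq_intros tau refl)+ (simp add: jtheta_minus deriv_jtheta_minus[OF tau] algebra_simps)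
  then have "?t (A + C) * ?t (B + C) * (?t (A + B) * ?d 0)
     = (?d A * ?t C + ?t A * ?d C) * ?t (A + B + C) * ?t B
        + (?d B * ?t (A + B + C) - ?t B * ?d (A + B + C)) * ?t C * ?t A"
    by (rule DERIV_unique[OF lhs[unfolded eq]])
  moreover have "?d A = E1 tau A * ?t A" "?d B = E1 tau B * ?t B" "?d C = E1 tau C * ?t C"
    "?d (A + B + C) = E1 tau (A + B + C) * ?t (A + B + C)"
    using nz by (simp_all add: E1_def)
  ultimately show ?thesis
    by algebra
qed

section \<open>Identities for the Kronecker function\<close>

text \<open>The addition formula at the three arguments \<open>z - w\<close>, \<open>a - b\<close>,
  \<open>w + b\<close>, whose sum is \<open>z + a\<close>. The thetas of the last argument and of
  the sum are the numerators of the two factors on the left; the pairwise sums are the numerators on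
  the right.\<close>

lemma ellphi_mult_E1:
  assumes tau: "Im tau > 0"
    and nz: "jtheta tau (z - w) \<noteq> 0" "jtheta tau (a - b) \<noteq> 0"
      "jtheta tau (z + a) \<noteq> 0" "jtheta tau (w + b) \<noteq> 0"
  shows "ellphi tau z a * ellphi tau w b * (E1 tau (z - w) + E1 tau (a - b) + E1 tau (w + b) - E1 tau (z + a))
    = ellphi tau (z - w) (a - b) * ellphi tau z b * ellphi tau w a"
proof -
  have eqs: "(z - w) + (a - b) + (w + b) = z + a" "(a - b) + (w + b) = w + a" "(z - w) + (w + b) = z + b"
    by simp_all
  have key: "(E1 tau (z - w) + E1 tau (a - b) + E1 tau (w + b) - E1 tau (z + a))
      * (jtheta tau (z - w) * jtheta tau (a - b) * jtheta tau (w + b) * jtheta tau (z + a))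
    = deriv (jtheta tau) 0 * jtheta tau (z - w + (a - b)) * jtheta tau (w + a) * jtheta tau (z + b)"
    using E1_addition[OF tau, of "z - w" "a - b" "w + b", unfolded eqs] nz by blast
  \<comment> \<open>Theta values are abstracted to letters. Both sides share the denominator
    \<open>tz * ta * tw * tb\<close>, so only \<open>tA\<close> and \<open>tB\<close> have to be
    cleared.\<close>
  have alg: "(d * sABC / (tz * ta)) * (d * tC / (tw * tb)) * S = (d * sAB / (tA * tB)) * (d * sAC / (tz * tb)) * (d * sBC / (tw * ta))"
    if "S * (tA * tB * tC * sABC) = d * sAB * sBC * sAC" "tA \<noteq> 0" "tB \<noteq> 0"
    for d sABC tz ta tC tw tb S sAB tA tB sAC sBC :: complex
  proof -
    have "S * tC * sABC = d * sAB * sBC * sAC / (tA * tB)"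
      using that by (simp add: field_simps)
    moreover have "(d * sABC / (tz * ta)) * (d * tC / (tw * tb)) * S = d * d * (S * tC * sABC) / (tz * ta * tw * tb)"
      by (simp add: mult_ac)
    ultimately show ?thesis
      by (simp add: mult_ac)
  qed
  show ?thesis
    unfolding ellphi_def by (rule alg[OF key nz(1,2)])
qed

text \<open>The addition formula turns the sum of \<open>E1\<close> values into a product containing
  \<open>jtheta tau (A + B)\<close>. This is the factor with which \<open>jtheta_fay\<close> splits
  the numerator into two products, giving the two terms on the right.\<close>

lemma ellphi_mult_E1':
  assumes tau: "Im tau > 0"
    and nz: "jtheta tau (z - w) \<noteq> 0" "jtheta tau A \<noteq> 0" "jtheta tau B \<noteq> 0" "jtheta tau C \<noteq> 0"
      "jtheta tau (A + B + C) \<noteq> 0" "jtheta tau (A + C) \<noteq> 0" "jtheta tau (B + C) \<noteq> 0"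
  shows "ellphi tau z (A + C) * ellphi tau w (B + C) * (E1 tau A + E1 tau B + E1 tau C - E1 tau (A + B + C))
    = ellphi tau (z - w) A * ellphi tau z C * ellphi tau w (A + B + C)
    - ellphi tau (z - w) (- B) * ellphi tau z (A + B + C) * ellphi tau w C"
proof -
  have alg: "(d * zac / (tz * tac)) * (d * wbc / (tw * tbc)) * S
      = (d * zwa / (tzw * ta)) * (d * zc / (tz * tc)) * (d * wabc / (tw * tabc))
      - (d * zwb / (tzw * - tb)) * (d * zabc / (tz * tabc)) * (d * wc / (tw * tc))"
    if E: "S * (ta * tb * tc * tabc) = d * tab * tbc * tac"
      and F: "zac * wbc * (tab * tzw) = zwa * zc * wabc * tb + zwb * zabc * wc * ta"
      and nz: "tzw \<noteq> 0" "ta \<noteq> 0" "tb \<noteq> 0" "tc \<noteq> 0" "tabc \<noteq> 0" "tac \<noteq> 0" "tbc \<noteq> 0"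
    for d zac tz tac wbc tw tbc S zwa tzw ta zc tc wabc tabc zwb tb zabc wc tab :: complex
  proof -
    have S: "S = d * tab * tbc * tac / (ta * tb * tc * tabc)"
      using E nz by (simp add: eq_divide_eq)
    have "(d * zac / (tz * tac)) * (d * wbc / (tw * tbc)) * S
        = d ^ 3 * (zac * wbc * (tab * tzw)) / (tz * tw * ta * tb * tc * tabc * tzw)"
      unfolding S using nz by (simp add: power3_eq_cube mult_ac)
    also have "\<dots> = d ^ 3 * (zwa * zc * wabc * tb) / (tz * tw * ta * tb * tc * tabc * tzw)
        + d ^ 3 * (zwb * zabc * wc * ta) / (tz * tw * ta * tb * tc * tabc * tzw)"
      unfolding F by (simp add: distrib_left add_divide_distrib)
    also have "d ^ 3 * (zwa * zc * wabc * tb) / (tz * tw * ta * tb * tc * tabc * tzw)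
        = (d * zwa / (tzw * ta)) * (d * zc / (tz * tc)) * (d * wabc / (tw * tabc))"
      using nz by (simp add: power3_eq_cube mult_ac)
    also have "d ^ 3 * (zwb * zabc * wc * ta) / (tz * tw * ta * tb * tc * tabc * tzw)
        = - ((d * zwb / (tzw * - tb)) * (d * zabc / (tz * tabc)) * (d * wc / (tw * tc)))"
      using nz by (simp add: power3_eq_cube mult_ac)
    finally show ?thesis
      by simp
  qed
  have fay: "jtheta tau (z + (A + C)) * jtheta tau (w + (B + C)) * (jtheta tau (A + B) * jtheta tau (z - w))
    = jtheta tau (z - w + A) * jtheta tau (z + C) * jtheta tau (w + (A + B + C)) * jtheta tau B
    + jtheta tau (z - w + - B) * jtheta tau (z + (A + B + C)) * jtheta tau (w + C) * jtheta tau A"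
    using jtheta_fay[OF tau, of z A C w B] by (simp only: add.assoc diff_conv_add_uminus)
  show ?thesis
    unfolding ellphi_def jtheta_minus[of tau B]
    by (rule alg[OF E1_addition[OF tau nz(2-5)] fay nz])
qed

section \<open>Logarithmic derivatives\<close>

text \<open>Writing every derivative as \<open>f x * F\<close> makes \<open>F\<close> additive over
  products and subtractive over quotients, so the derivative of an entry of \<open>L\<close> is that
  entry times a sum of \<open>E1\<close> values.\<close>

lemma log_derivative_mult:
  fixes f g :: "complex \<Rightarrow> complex"
  assumes "(f has_field_derivative f x * F) (at x)" "(g has_field_derivative g x * G) (at x)"
  shows "((\<lambda>x. f x * g x) has_field_derivative (f x * g x) * (F + G)) (at x)"
  using DERIV_mult[OF assms] by (rule DERIV_cong) (simp add: algebra_simps)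

lemma log_derivative_divide:
  fixes f g :: "complex \<Rightarrow> complex"
  assumes "(f has_field_derivative f x * F) (at x)" "(g has_field_derivative g x * G) (at x)" "g x \<noteq> 0"
  shows "((\<lambda>x. f x / g x) has_field_derivative (f x / g x) * (F - G)) (at x)"
  using DERIV_divide[OF assms] by (rule DERIV_cong) (use assms(3) in \<open>simp add: field_simps\<close>)

lemma log_derivative_prod:
  fixes f :: "'a \<Rightarrow> complex \<Rightarrow> complex"
  assumes "\<And>l. l \<in> S \<Longrightarrow> (f l has_field_derivative f l x * F l) (at x)" "\<And>l. l \<in> S \<Longrightarrow> f l x \<noteq> 0"
  shows "((\<lambda>x. \<Prod>l\<in>S. f l x) has_field_derivative (\<Prod>l\<in>S. f l x) * (\<Sum>l\<in>S. F l)) (at x)"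
  using has_field_derivative_prod'[of S f x "\<lambda>l. f l x * F l"] assms by simp

lemma log_derivative_jtheta:
  assumes "Im tau > 0" "(g has_field_derivative g') (at x)" "jtheta tau (g x) \<noteq> 0"
  shows "((\<lambda>x. jtheta tau (g x)) has_field_derivative jtheta tau (g x) * (E1 tau (g x) * g')) (at x)"
  using has_field_derivative_jtheta_chain[OF assms(1,2)]
  by (rule DERIV_cong) (use assms(3) in \<open>simp add: E1_def\<close>)

lemma log_derivative_ellphi:
  assumes "Im tau > 0" "(g has_field_derivative g') (at x)" "jtheta tau (g x) \<noteq> 0" "jtheta tau (z + g x) \<noteq> 0"
    "jtheta tau z \<noteq> 0"
  shows "((\<lambda>x. ellphi tau z (g x)) has_field_derivative
    ellphi tau z (g x) * ((E1 tau (z + g x) - E1 tau (g x)) * g')) (at x)"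
proof -
  \<comment> \<open>Constants fit the same pattern with logarithmic derivative 0.\<close>
  have const: "((\<lambda>x. k) has_field_derivative k * 0) (at x)" for k :: complex
    by simp
  have "((\<lambda>x. z + g x) has_field_derivative g') (at x)"
    using DERIV_add[OF DERIV_const assms(2)] by simp
  from log_derivative_divide[OF log_derivative_mult[OF const[of "deriv (jtheta tau) 0"]
        log_derivative_jtheta[OF assms(1) this assms(4)]]
      log_derivative_mult[OF const[of "jtheta tau z"] log_derivative_jtheta[OF assms(1-3)]]]
  show ?thesis
    using assms(3,5) by (simp add: ellphi_def algebra_simps)
qed

text \<open>Differentiation is along an arbitrary curve \<open>Q\<close> with velocity
  \<open>Q'\<close>. This covers \<open>n = 1\<close>, where the site and its predecessor coincide
  and one moving coordinate enters in both roles.\<close>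

lemma log_derivative_Lmat:
  fixes Q :: "complex \<Rightarrow> nat \<Rightarrow> 'N::finite \<Rightarrow> complex"
  assumes tau: "Im tau > 0"
    and Q: "\<And>d m. ((\<lambda>x. Q x d m) has_field_derivative Q' d m) (at x)"
    and eta: "jtheta tau (- eta) \<noteq> 0" and z: "jtheta tau z \<noteq> 0"
    and nz: "\<And>i j. jtheta tau (Q x (cprev n a) i - Q x a j + eta) \<noteq> 0"
      "\<And>i j. jtheta tau (z + Q x (cprev n a) i - Q x a j + eta) \<noteq> 0"
      "\<And>i j. i \<noteq> j \<Longrightarrow> jtheta tau (Q x a i - Q x a j) \<noteq> 0"
  shows "((\<lambda>x. Lmat tau eta c n a z p (Q x) $ i $ j) has_field_derivative
    Lmat tau eta c n a z p (Q x) $ i $ j *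
      ((E1 tau (z + Q x (cprev n a) i - Q x a j + eta) - E1 tau (Q x (cprev n a) i - Q x a j + eta))
          * (Q' (cprev n a) i - Q' a j)
        + (\<Sum>l\<in>UNIV. E1 tau (Q x a j - Q x (cprev n a) l - eta) * (Q' a j - Q' (cprev n a) l))
        - (\<Sum>l\<in>UNIV - {j}. E1 tau (Q x a j - Q x a l) * (Q' a j - Q' a l)))) (at x)"
proof -
  have const: "((\<lambda>x. k) has_field_derivative k * 0) (at x)" for k :: complex
    by simp
  have assoc: "z + (Q x (cprev n a) i - Q x a j + eta) = z + Q x (cprev n a) i - Q x a j + eta"
    by simp
  have u: "((\<lambda>x. Q x (cprev n a) i - Q x a j + eta) has_field_derivative Q' (cprev n a) i - Q' a j) (at x)"
    by (auto intro!: derivative_eq_intros Q)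
  have v: "((\<lambda>x. Q x a j - Q x (cprev n a) l - eta) has_field_derivative Q' a j - Q' (cprev n a) l) (at x)" for l
    by (auto intro!: derivative_eq_intros Q)
  have y: "((\<lambda>x. Q x a j - Q x a l) has_field_derivative Q' a j - Q' a l) (at x)" for l
    by (auto intro!: derivative_eq_intros Q)
  have v_nz: "jtheta tau (Q x a j - Q x (cprev n a) l - eta) \<noteq> 0" for l
    using nz(1)[of l j] jtheta_minus[of tau "Q x (cprev n a) l - Q x a j + eta"]
    by (simp add: algebra_simps)
  have y_nz: "jtheta tau (Q x a j - Q x a l) \<noteq> 0" if "l \<in> UNIV - {j}" for l
    using nz(3)[of j l] that by auto
  note phi = log_derivative_ellphi[OF tau u nz(1) nz(2)[of i j, folded assoc] z]
  note num = log_derivative_prod[of UNIV, OF log_derivative_jtheta[OF tau v v_nz] v_nz]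
  note den = log_derivative_mult[OF const[of "jtheta tau (- eta)"]
      log_derivative_prod[of "UNIV - {j}", OF log_derivative_jtheta[OF tau y y_nz] y_nz]]
  have den_nz: "jtheta tau (- eta) * (\<Prod>l\<in>UNIV - {j}. jtheta tau (Q x a j - Q x a l)) \<noteq> 0"
    using eta y_nz by auto
  show ?thesis
    using log_derivative_mult[OF log_derivative_divide[OF log_derivative_mult[OF phi num] den den_nz] const[of "exp (p a j / c)"]]
    unfolding assoc by (simp add: Lmat_def)
qed

section \<open>Matrix components\<close>

lemma sum_UNIV_single:
  fixes f :: "'a::finite \<Rightarrow> complex"
  assumes "\<And>i. i \<noteq> a \<Longrightarrow> f i = 0"
  shows "sum f UNIV = f a"
proof -
  have "sum f UNIV = sum f {a}"
    by (rule sum.mono_neutral_right) (use assms in auto)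
  thus ?thesis by simp
qed

lemma sum_pair_single:
  fixes g :: "'a::finite \<Rightarrow> 'b::finite \<Rightarrow> complex"
  assumes "\<And>i k. i \<noteq> a \<or> k \<noteq> b \<Longrightarrow> g i k = 0"
  shows "(\<Sum>i\<in>UNIV. \<Sum>k\<in>UNIV. g i k) = g a b"
proof -
  have "(\<Sum>i\<in>UNIV. \<Sum>k\<in>UNIV. g i k) = (\<Sum>k\<in>UNIV. g a k)"
    by (rule sum_UNIV_single) (simp add: assms)
  also have "\<dots> = g a b"
    by (rule sum_UNIV_single) (simp add: assms)
  finally show ?thesis .
qed

lemma sum_diff_single:
  fixes f :: "'a::finite \<Rightarrow> complex"
  shows "sum f (UNIV - {i}) = (\<Sum>j\<in>UNIV. if j = i then 0 else f j)"
  by (rule sum.mono_neutral_cong_left) auto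

lemma sum_diag_units:
  fixes g :: "'a::finite \<Rightarrow> 'a \<Rightarrow> complex"
  shows "(\<Sum>i'\<in>UNIV. \<Sum>k'\<in>UNIV. g i' k' * (of_bool (i = i' \<and> j = i') * of_bool (k = k' \<and> l = k')))
    = of_bool (i = j \<and> k = l) * g i k"
proof -
  have "(\<Sum>i'\<in>UNIV. \<Sum>k'\<in>UNIV. g i' k' * (of_bool (i = i' \<and> j = i') * of_bool (k = k' \<and> l = k')))
    = (\<Sum>k'\<in>UNIV. g i k' * (of_bool (i = i \<and> j = i) * of_bool (k = k' \<and> l = k')))"
    by (rule sum_UNIV_single) auto
  also have "\<dots> = g i k * (of_bool (i = i \<and> j = i) * of_bool (k = k \<and> l = k))"
    by (rule sum_UNIV_single) auto
  finally show ?thesis by auto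
qed

lemma sum_swap_units:
  fixes g :: "'a::finite \<Rightarrow> 'a \<Rightarrow> complex"
  shows "(\<Sum>i'\<in>UNIV. \<Sum>j'\<in>UNIV. g i' j' * (of_bool (i = i' \<and> j = j') * of_bool (k = j' \<and> l = i')))
    = of_bool (i = l \<and> k = j) * g i k"
proof -
  have "(\<Sum>i'\<in>UNIV. \<Sum>j'\<in>UNIV. g i' j' * (of_bool (i = i' \<and> j = j') * of_bool (k = j' \<and> l = i')))
    = (\<Sum>j'\<in>UNIV. g i j' * (of_bool (i = i \<and> j = j') * of_bool (k = j' \<and> l = i)))"
    by (rule sum_UNIV_single) auto
  also have "\<dots> = g i k * (of_bool (i = i \<and> j = k) * of_bool (k = k \<and> l = i))"
    by (rule sum_UNIV_single) auto
  finally show ?thesis by auto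
qed

lemma tens_munit_nth:
  "tens (munit i' j') (munit k' l') $ (i, k) $ (j, l) = of_bool (i = i' \<and> j = j') * of_bool (k = k' \<and> l = l')"
  by (simp add: tens_def munit_def)

lemma smat_tens_munit_nth:
  "smat x (tens (munit i' j') (munit k' l')) $ (i, k) $ (j, l)
    = x * (of_bool (i = i' \<and> j = j') * of_bool (k = k' \<and> l = l'))"
  by (simp add: smat_def tens_munit_nth)

text \<open>The split is into a permutation part and a diagonal part. Where the two patterns meet,
  at \<open>i = k\<close>, the value \<open>E1 tau (z - w)\<close> is assigned to the diagonal part,
  so each part has one coefficient per row pair.\<close>

lemma rmat_nth:
  "rmat tau a q z w $ (i, k) $ (j, l)
    = of_bool (i = l \<and> k = j) * (if k = i then 0 else ellphi tau (z - w) (q a i - q a k))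
      + of_bool (i = j \<and> k = l) * (if k = i then E1 tau (z - w) else - E1 tau (q a i - q a k))"
proof -
  have 1: "(\<Sum>i'\<in>UNIV. \<Sum>j'\<in>UNIV - {i'}. smat (ellphi tau (z - w) (q a i' - q a j'))
        (tens (munit i' j') (munit j' i'))) $ (i, k) $ (j, l)
    = of_bool (i = l \<and> k = j) * (if k = i then 0 else ellphi tau (z - w) (q a i - q a k))"
    by (rule trans[OF _ sum_swap_units])
      (auto simp: smat_tens_munit_nth sum_diff_single intro!: sum.cong)
  have 3: "(\<Sum>i'\<in>UNIV. \<Sum>j'\<in>UNIV - {i'}. smat (E1 tau (q a i' - q a j'))
        (tens (munit i' i') (munit j' j'))) $ (i, k) $ (j, l)
    = of_bool (i = j \<and> k = l) * (if k = i then 0 else E1 tau (q a i - q a k))"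
    by (rule trans[OF _ sum_diag_units])
      (auto simp: smat_tens_munit_nth sum_diff_single intro!: sum.cong)
  have "(\<Sum>i'\<in>UNIV. tens (munit i' i') (munit i' i')) $ (i, k) $ (j, l)
    = (\<Sum>i'\<in>UNIV. of_bool (i = i' \<and> j = i') * of_bool (k = i' \<and> l = i'))"
    by (simp only: sum_component tens_munit_nth)
  also have "\<dots> = of_bool (i = i \<and> j = i) * of_bool (k = i \<and> l = i)"
    by (rule sum_UNIV_single) auto
  finally have 2: "smat (E1 tau (z - w)) (\<Sum>i'\<in>UNIV. tens (munit i' i') (munit i' i')) $ (i, k) $ (j, l)
    = of_bool (i = j \<and> k = l) * (if k = i then E1 tau (z - w) else 0)"
    by (auto simp: smat_def)
  show ?thesis
    unfolding rmat_def vector_add_component vector_minus_component 1 2 3 by simp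
qed

lemma uplus_nth:
  "uplus tau eta n a q $ (i, k) $ (j, l) = of_bool (i = j \<and> k = l) * E1 tau (q (cprev n a) k - q a i + eta)"
  by (rule trans[OF _ sum_diag_units]) (simp add: uplus_def smat_tens_munit_nth)

lemma uminus_mat_nth:
  "uminus_mat tau eta n a q $ (i, k) $ (j, l)
    = - (of_bool (i = j \<and> k = l) * E1 tau (q (cprev n a) i - q a l + eta))"
  using sum_diag_units[of "\<lambda>i j. E1 tau (q (cprev n a) i - q a j + eta)" i j k l]
  by (auto simp: uminus_mat_def smat_tens_munit_nth)

lemma s12_nth:
  "s12 tau eta c n a z p q $ (i, k) $ (j, l)
    = of_bool (k = l) * (matrix_inv (Lmat tau eta c n a z p q) $ i $ k * Dmat tau eta c n a z p q $ k $ j)"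
proof -
  let ?g = "\<lambda>i' j' m'. matrix_inv (Lmat tau eta c n a z p q) $ m' $ i' * Dmat tau eta c n a z p q $ i' $ j'
    * (of_bool (i = m' \<and> j = j') * of_bool (k = i' \<and> l = i'))"
  have "s12 tau eta c n a z p q $ (i, k) $ (j, l) = (\<Sum>i'\<in>UNIV. \<Sum>j'\<in>UNIV. \<Sum>m'\<in>UNIV. ?g i' j' m')"
    by (simp add: s12_def smat_tens_munit_nth)
  also have "\<dots> = (\<Sum>j'\<in>UNIV. \<Sum>m'\<in>UNIV. ?g k j' m')"
    by (rule sum_UNIV_single) auto
  also have "\<dots> = (\<Sum>m'\<in>UNIV. ?g k j m')"
    by (rule sum_UNIV_single) auto
  also have "\<dots> = ?g k j i"
    by (rule sum_UNIV_single) auto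
  finally show ?thesis by auto
qed

lemma s21_nth:
  "s21 tau eta c n a w p q $ (i, k) $ (j, l)
    = of_bool (i = j) * (matrix_inv (Lmat tau eta c n a w p q) $ k $ i * Dmat tau eta c n a w p q $ i $ l)"
proof -
  let ?g = "\<lambda>i' j' m'. matrix_inv (Lmat tau eta c n a w p q) $ m' $ i' * Dmat tau eta c n a w p q $ i' $ j'
    * (of_bool (i = i' \<and> j = i') * of_bool (k = m' \<and> l = j'))"
  have "s21 tau eta c n a w p q $ (i, k) $ (j, l) = (\<Sum>i'\<in>UNIV. \<Sum>j'\<in>UNIV. \<Sum>m'\<in>UNIV. ?g i' j' m')"
    by (simp add: s21_def smat_tens_munit_nth)
  also have "\<dots> = (\<Sum>j'\<in>UNIV. \<Sum>m'\<in>UNIV. ?g i j' m')"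
    by (rule sum_UNIV_single) auto
  also have "\<dots> = (\<Sum>m'\<in>UNIV. ?g i l m')"
    by (rule sum_UNIV_single) auto
  also have "\<dots> = ?g i l k"
    by (rule sum_UNIV_single) auto
  finally show ?thesis by auto
qed

section \<open>Products with tensor factors\<close>

lemma sum_UNIV_Pair:
  fixes f :: "'a::finite \<times> 'b::finite \<Rightarrow> complex"
  shows "sum f UNIV = (\<Sum>i\<in>UNIV. \<Sum>k\<in>UNIV. f (i, k))"
  by (simp add: sum.cartesian_product)

lemma tens_mult_nth:
  "(tens A B ** M) $ (i, k) $ y = (\<Sum>i'\<in>UNIV. \<Sum>k'\<in>UNIV. A $ i $ i' * B $ k $ k' * M $ (i', k') $ y)"
  by (simp add: matrix_matrix_mult_def tens_def sum_UNIV_Pair)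

lemma mult_tens_nth:
  "(M ** tens A B) $ x $ (j, l) = (\<Sum>j'\<in>UNIV. \<Sum>l'\<in>UNIV. M $ x $ (j', l') * (A $ j' $ j * B $ l' $ l))"
  by (simp add: matrix_matrix_mult_def tens_def sum_UNIV_Pair)

lemma tens_mat1_mult_nth:
  fixes A :: "complex^'n^'n"
  shows "(tens A (mat 1) ** M) $ (i, k) $ y = (\<Sum>i'\<in>UNIV. A $ i $ i' * M $ (i', k) $ y)"
proof -
  have "(\<Sum>k'\<in>UNIV. A $ i $ i' * (mat 1 :: complex^'n^'n) $ k $ k' * M $ (i', k') $ y)
    = A $ i $ i' * (mat 1 :: complex^'n^'n) $ k $ k * M $ (i', k) $ y" for i'
    by (rule sum_UNIV_single) (simp add: mat_def)
  thus ?thesis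
    by (simp add: tens_mult_nth mat_def)
qed

lemma mat1_tens_mult_nth:
  fixes B :: "complex^'n^'n"
  shows "(tens (mat 1) B ** M) $ (i, k) $ y = (\<Sum>k'\<in>UNIV. B $ k $ k' * M $ (i, k') $ y)"
proof -
  have "(\<Sum>i'\<in>UNIV. \<Sum>k'\<in>UNIV. (mat 1 :: complex^'n^'n) $ i $ i' * B $ k $ k' * M $ (i', k') $ y)
    = (\<Sum>k'\<in>UNIV. (mat 1 :: complex^'n^'n) $ i $ i * B $ k $ k' * M $ (i, k') $ y)"
    by (rule sum_UNIV_single) (simp add: mat_def)
  thus ?thesis
    by (simp add: tens_mult_nth mat_def)
qed

lemma mult_tens_mat1_nth:
  fixes A :: "complex^'n^'n"
  shows "(M ** tens A (mat 1)) $ x $ (j, l) = (\<Sum>j'\<in>UNIV. M $ x $ (j', l) * A $ j' $ j)"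
proof -
  have "(\<Sum>l'\<in>UNIV. M $ x $ (j', l') * (A $ j' $ j * (mat 1 :: complex^'n^'n) $ l' $ l))
    = M $ x $ (j', l) * (A $ j' $ j * (mat 1 :: complex^'n^'n) $ l $ l)" for j'
    by (rule sum_UNIV_single) (simp add: mat_def)
  thus ?thesis
    by (simp add: mult_tens_nth mat_def)
qed

lemma mult_mat1_tens_nth:
  fixes B :: "complex^'n^'n"
  shows "(M ** tens (mat 1) B) $ x $ (j, l) = (\<Sum>l'\<in>UNIV. M $ x $ (j, l') * B $ l' $ l)"
proof -
  have "(\<Sum>j'\<in>UNIV. \<Sum>l'\<in>UNIV. M $ x $ (j', l') * ((mat 1 :: complex^'n^'n) $ j' $ j * B $ l' $ l))
    = (\<Sum>l'\<in>UNIV. M $ x $ (j, l') * ((mat 1 :: complex^'n^'n) $ j $ j * B $ l' $ l))"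
    by (rule sum_UNIV_single) (simp add: mat_def)
  thus ?thesis
    by (simp add: mult_tens_nth mat_def)
qed

lemma tens_mat1_mult_mat1_tens:
  fixes A B :: "complex^'n^'n"
  shows "tens A (mat 1) ** tens (mat 1) B = tens A B"
proof -
  have "(tens A (mat 1) ** tens (mat 1) B) $ (i, k) $ (j, l) = tens A B $ (i, k) $ (j, l)" for i j k l
  proof -
    have "(tens A (mat 1) ** tens (mat 1) B) $ (i, k) $ (j, l)
      = (\<Sum>i'\<in>UNIV. A $ i $ i' * ((mat 1 :: complex^'n^'n) $ i' $ j * B $ k $ l))"
      unfolding tens_mat1_mult_nth by (simp add: tens_def)
    also have "\<dots> = A $ i $ j * ((mat 1 :: complex^'n^'n) $ j $ j * B $ k $ l)"
      by (rule sum_UNIV_single) (simp add: mat_def)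
    finally show ?thesis
      by (simp add: tens_def mat_def)
  qed
  thus ?thesis
    by (simp add: vec_eq_iff)
qed

lemma mat1_tens_mult_tens_mat1:
  fixes A B :: "complex^'n^'n"
  shows "tens (mat 1) B ** tens A (mat 1) = tens A B"
proof -
  have "(tens (mat 1) B ** tens A (mat 1)) $ (i, k) $ (j, l) = tens A B $ (i, k) $ (j, l)" for i j k l
  proof -
    have "(tens (mat 1) B ** tens A (mat 1)) $ (i, k) $ (j, l)
      = (\<Sum>k'\<in>UNIV. B $ k $ k' * (A $ i $ j * (mat 1 :: complex^'n^'n) $ k' $ l))"
      unfolding mat1_tens_mult_nth by (simp add: tens_def)
    also have "\<dots> = B $ k $ l * (A $ i $ j * (mat 1 :: complex^'n^'n) $ l $ l)"
      by (rule sum_UNIV_single) (simp add: mat_def)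
    finally show ?thesis
      by (simp add: tens_def mat_def)
  qed
  thus ?thesis
    by (simp add: vec_eq_iff)
qed

text \<open>This is the cancellation of \<open>L\<close> against the inverse inside
  \<open>s\<close>, in the form in which it appears after expanding components; \<open>x\<close>
  stands for an entry of \<open>Dmat\<close>.\<close>

lemma sum_matrix_inv:
  fixes A :: "complex^'n^'n"
  assumes "invertible A"
  shows "(\<Sum>m\<in>UNIV. A $ i $ m * (matrix_inv A $ m $ k * x)) = of_bool (i = k) * x"
proof -
  have "(\<Sum>m\<in>UNIV. A $ i $ m * (matrix_inv A $ m $ k * x)) = (A ** matrix_inv A) $ i $ k * x"
    by (simp add: matrix_matrix_mult_def sum_distrib_right mult.assoc)
  also have "A ** matrix_inv A = mat 1"
    \<comment> \<open>\<open>matrix_inv\<close> is a Hilbert choice, so invertibility is what makes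
      the chosen matrix an inverse.\<close>
    using someI_ex[OF assms[unfolded invertible_def]] unfolding matrix_inv_def by blast
  finally show ?thesis
    by (simp add: mat_def)
qed

section \<open>The Poisson bracket of the Lax matrices\<close>

text \<open>The partial derivatives of \<open>L\<^sup>a\<^sub>i\<^sub>j\<close> in \<open>q\<^sup>a\<^sup>-\<^sup>1\<^sub>m\<close> and in \<open>q\<^sup>a\<^sub>m\<close>, taken as if the two families of
  coordinates were independent; for \<open>n = 1\<close> they coincide and the true derivative is the sum.\<close>

definition Lmat_dprev :: "complex \<Rightarrow> complex \<Rightarrow> complex \<Rightarrow> nat \<Rightarrow> nat \<Rightarrow> complex
     \<Rightarrow> 'N::finite coords \<Rightarrow> 'N coords \<Rightarrow> 'N \<Rightarrow> 'N \<Rightarrow> 'N \<Rightarrow> complex" where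
  "Lmat_dprev tau eta c n a z p q m i j = of_bool (m = i) * Dmat tau eta c n a z p q $ i $ j
      + Lmat tau eta c n a z p q $ i $ j * E1 tau (q (cprev n a) m - q a j + eta)"

definition Lmat_dsite :: "complex \<Rightarrow> complex \<Rightarrow> complex \<Rightarrow> nat \<Rightarrow> nat \<Rightarrow> complex
     \<Rightarrow> 'N::finite coords \<Rightarrow> 'N coords \<Rightarrow> 'N \<Rightarrow> 'N \<Rightarrow> 'N \<Rightarrow> complex" where
  "Lmat_dsite tau eta c n a z p q m i j =
     (if m = j then
        Lmat tau eta c n a z p q $ i $ j
          * ((\<Sum>l\<in>UNIV. E1 tau (q a j - q (cprev n a) l - eta)) - (\<Sum>l\<in>UNIV - {j}. E1 tau (q a j - q a l)))
        - Dmat tau eta c n a z p q $ i $ j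
      else Lmat tau eta c n a z p q $ i $ j * E1 tau (q a j - q a m))"

lemma dq_Lmat:
  fixes q :: "'N::finite coords"
  assumes tau: "Im tau > 0" and eta: "jtheta tau (- eta) \<noteq> 0" and z: "jtheta tau z \<noteq> 0"
    and nz: "\<And>i j. jtheta tau (q (cprev n a) i - q a j + eta) \<noteq> 0"
      "\<And>i j. jtheta tau (z + q (cprev n a) i - q a j + eta) \<noteq> 0"
      "\<And>i j. i \<noteq> j \<Longrightarrow> jtheta tau (q a i - q a j) \<noteq> 0"
  shows "dq d m (\<lambda>p q. Lmat tau eta c n a z p q $ i $ j) p q
    = of_bool (d = a) * Lmat_dsite tau eta c n a z p q m i j
    + of_bool (d = cprev n a) * Lmat_dprev tau eta c n a z p q m i j"
proof -
  let ?Q = "\<lambda>x. q(d := (q d)(m := x))"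
  let ?L = "Lmat tau eta c n a z p q $ i $ j"
  \<comment> \<open>The velocity of the coordinate \<open>q e k\<close> when only
    \<open>q d m\<close> moves.\<close>
  define \<delta> :: "nat \<Rightarrow> 'N \<Rightarrow> complex" where "\<delta> e k = of_bool (e = d \<and> k = m)" for e k
  have Q: "((\<lambda>x. ?Q x e k) has_field_derivative \<delta> e k) (at (q d m))" for e k
    by (cases "e = d"; cases "k = m") (auto simp: \<delta>_def)
  have triv: "?Q (q d m) = q"
    by simp
  \<comment> \<open>Oddness brings the numerator's argument to the form used in \<open>uplus\<close>
    and \<open>uminus_mat\<close>.\<close>
  have v: "E1 tau (q a j - q (cprev n a) m - eta) = - E1 tau (q (cprev n a) m - q a j + eta)"
    using E1_minus[OF tau, of "q (cprev n a) m - q a j + eta"] by (simp add: algebra_simps)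
  have 1: "(\<Sum>l\<in>UNIV. E1 tau (q a j - q (cprev n a) l - eta) * (\<delta> a j - \<delta> (cprev n a) l))
     = \<delta> a j * (\<Sum>l\<in>UNIV. E1 tau (q a j - q (cprev n a) l - eta))
       + of_bool (d = cprev n a) * E1 tau (q (cprev n a) m - q a j + eta)"
  proof -
    have "(\<Sum>l\<in>UNIV. E1 tau (q a j - q (cprev n a) l - eta) * \<delta> (cprev n a) l)
       = E1 tau (q a j - q (cprev n a) m - eta) * \<delta> (cprev n a) m"
      by (rule sum_UNIV_single) (simp add: \<delta>_def)
    moreover have "(\<Sum>l\<in>UNIV. E1 tau (q a j - q (cprev n a) l - eta) * (\<delta> a j - \<delta> (cprev n a) l))
      = \<delta> a j * (\<Sum>l\<in>UNIV. E1 tau (q a j - q (cprev n a) l - eta))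
       - (\<Sum>l\<in>UNIV. E1 tau (q a j - q (cprev n a) l - eta) * \<delta> (cprev n a) l)"
      by (simp only: right_diff_distrib sum_subtractf sum_distrib_left mult.commute[of _ "\<delta> a j"])
    ultimately show ?thesis
      by (auto simp: v \<delta>_def)
  qed
  \<comment> \<open>If \<open>q a j\<close> itself moves, all summands contribute; if another
    \<open>q a m\<close> moves, only \<open>l = m\<close> does, and \<open>m = j\<close> is outside
    the range.\<close>
  have 2: "(\<Sum>l\<in>UNIV - {j}. E1 tau (q a j - q a l) * (\<delta> a j - \<delta> a l))
     = \<delta> a j * (\<Sum>l\<in>UNIV - {j}. E1 tau (q a j - q a l))
       - of_bool (d = a \<and> m \<noteq> j) * E1 tau (q a j - q a m)"
  proof -
    have "(\<Sum>l\<in>UNIV - {j}. E1 tau (q a j - q a l) * \<delta> a l)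
       = (if m = j then 0 else E1 tau (q a j - q a m) * \<delta> a m)"
      unfolding sum_diff_single by (rule sum_UNIV_single) (simp add: \<delta>_def)
    moreover have "(\<Sum>l\<in>UNIV - {j}. E1 tau (q a j - q a l) * (\<delta> a j - \<delta> a l))
      = \<delta> a j * (\<Sum>l\<in>UNIV - {j}. E1 tau (q a j - q a l))
       - (\<Sum>l\<in>UNIV - {j}. E1 tau (q a j - q a l) * \<delta> a l)"
      by (simp only: right_diff_distrib sum_subtractf sum_distrib_left mult.commute[of _ "\<delta> a j"])
    ultimately show ?thesis
      by (auto simp: \<delta>_def)
  qed
  note der = log_derivative_Lmat[where Q = ?Q and Q' = \<delta> and x = "q d m" and n = n and a = a and p = p and c = c
      and i = i and j = j, OF tau Q eta z, unfolded triv, OF nz]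
  have D: "Dmat tau eta c n a z p q $ i $ j = ?L *
      (E1 tau (z + q (cprev n a) i - q a j + eta) - E1 tau (q (cprev n a) i - q a j + eta))"
    by (simp add: Dmat_def)
  have "dq d m (\<lambda>p q. Lmat tau eta c n a z p q $ i $ j) p q = ?L *
      ((E1 tau (z + q (cprev n a) i - q a j + eta) - E1 tau (q (cprev n a) i - q a j + eta))
          * (\<delta> (cprev n a) i - \<delta> a j)
        + (\<delta> a j * (\<Sum>l\<in>UNIV. E1 tau (q a j - q (cprev n a) l - eta))
          + of_bool (d = cprev n a) * E1 tau (q (cprev n a) m - q a j + eta))
        - (\<delta> a j * (\<Sum>l\<in>UNIV - {j}. E1 tau (q a j - q a l))
          - of_bool (d = a \<and> m \<noteq> j) * E1 tau (q a j - q a m)))"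
    unfolding dq_def using DERIV_imp_deriv[OF der] unfolding 1 2 .
  also have "\<dots> = ?L * (\<delta> a j * ((\<Sum>l\<in>UNIV. E1 tau (q a j - q (cprev n a) l - eta)) - (\<Sum>l\<in>UNIV - {j}. E1 tau (q a j - q a l)))
        - (E1 tau (z + q (cprev n a) i - q a j + eta) - E1 tau (q (cprev n a) i - q a j + eta)) * \<delta> a j
        + of_bool (d = a \<and> m \<noteq> j) * E1 tau (q a j - q a m))
      + ?L * ((E1 tau (z + q (cprev n a) i - q a j + eta) - E1 tau (q (cprev n a) i - q a j + eta)) * \<delta> (cprev n a) i
        + of_bool (d = cprev n a) * E1 tau (q (cprev n a) m - q a j + eta))"
  \<comment> \<open>Regrouping into the terms with the velocity at site \<open>a\<close> and those
    with the velocity at the preceding site, with the sums hidden behind letters.\<close>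
  proof -
    have "L * (e * (di - da) + (da * s + r) - (da * s' - r')) = L * (da * (s - s') - e * da + r') + L * (e * di + r)"
      for L e di da s r s' r' :: complex
      by (simp add: algebra_simps)
    thus ?thesis .
  qed
  also have "?L * (\<delta> a j * ((\<Sum>l\<in>UNIV. E1 tau (q a j - q (cprev n a) l - eta)) - (\<Sum>l\<in>UNIV - {j}. E1 tau (q a j - q a l)))
        - (E1 tau (z + q (cprev n a) i - q a j + eta) - E1 tau (q (cprev n a) i - q a j + eta)) * \<delta> a j
        + of_bool (d = a \<and> m \<noteq> j) * E1 tau (q a j - q a m))
      = of_bool (d = a) * Lmat_dsite tau eta c n a z p q m i j"
    unfolding Lmat_dsite_def D \<delta>_def by (simp add: right_diff_distrib)
  also have "?L * ((E1 tau (z + q (cprev n a) i - q a j + eta) - E1 tau (q (cprev n a) i - q a j + eta)) * \<delta> (cprev n a) i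
        + of_bool (d = cprev n a) * E1 tau (q (cprev n a) m - q a j + eta))
      = of_bool (d = cprev n a) * Lmat_dprev tau eta c n a z p q m i j"
    unfolding Lmat_dprev_def D \<delta>_def by (auto simp: distrib_left)
  finally show ?thesis .
qed

lemma dp_Lmat:
  assumes "c \<noteq> 0"
  shows "dp d m (\<lambda>p q. Lmat tau eta c n a z p q $ i $ j) p q
    = of_bool (d = a \<and> m = j) * (Lmat tau eta c n a z p q $ i $ j / c)"
proof -
  \<comment> \<open>The momentum-free prefactor, obtained at zero momenta where the exponential is
    1.\<close>
  define K where "K = Lmat tau eta c n a z (\<lambda>_ _. 0) q $ i $ j"
  have L: "Lmat tau eta c n a z p q $ i $ j = K * exp (p a j / c)" for p
    by (simp add: K_def Lmat_def)
  have "((\<lambda>x. K * exp ((p(d := (p d)(m := x))) a j / c)) has_field_derivative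
      of_bool (d = a \<and> m = j) * (K * exp (p a j / c) / c)) (at (p d m))"
    using assms by (cases "d = a"; cases "m = j") (auto intro!: derivative_eq_intros)
  from DERIV_imp_deriv[OF this] show ?thesis
    unfolding dp_def L .
qed

lemma pb_Lmat:
  fixes q :: "'N::finite coords"
  assumes c: "c \<noteq> 0" and a: "a \<in> {1..n}" and b: "b \<in> {1..n}"
  shows "c * pb n (\<lambda>p q. Lmat tau eta c n a z p q $ i $ j) (\<lambda>p q. Lmat tau eta c n b w p q $ k $ l) p q
    = Lmat tau eta c n a z p q $ i $ j * dq a j (\<lambda>p q. Lmat tau eta c n b w p q $ k $ l) p q
    - Lmat tau eta c n b w p q $ k $ l * dq b l (\<lambda>p q. Lmat tau eta c n a z p q $ i $ j) p q"
proof -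
  \<comment> \<open>A matrix entry depends on one momentum only, so each half of the bracket
    collapses to one summand: site \<open>a\<close>, index \<open>j\<close> in the first, site
    \<open>b\<close>, index \<open>l\<close> in the second.\<close>
  have single: "(\<Sum>d\<in>{1..n}. \<Sum>m\<in>UNIV. of_bool (d = e \<and> m = s) * x * f d m) = x * f e s"
    if e: "e \<in> {1..n}" for e s x and f :: "nat \<Rightarrow> 'N \<Rightarrow> complex"
  proof -
    have "(\<Sum>m\<in>UNIV. of_bool (d = e \<and> m = s) * x * f d m) = of_bool (d = e \<and> s = s) * x * f d s" for d
      by (rule sum_UNIV_single) simp
    also have "of_bool (d = e \<and> s = s) * x * f d s = (if d = e then x * f e s else 0)" for d
      by simp
    finally have "(\<Sum>d\<in>{1..n}. \<Sum>m\<in>UNIV. of_bool (d = e \<and> m = s) * x * f d m)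
        = (\<Sum>d\<in>{1..n}. if d = e then x * f e s else 0)"
      by (rule sum.cong[OF refl])
    also have "\<dots> = x * f e s"
      using e by simp
    finally show ?thesis .
  qed
  let ?A = "Lmat tau eta c n a z p q $ i $ j" and ?B = "Lmat tau eta c n b w p q $ k $ l"
  let ?f = "\<lambda>d m. dq d m (\<lambda>p q. Lmat tau eta c n a z p q $ i $ j) p q"
  let ?g = "\<lambda>d m. dq d m (\<lambda>p q. Lmat tau eta c n b w p q $ k $ l) p q"
  have "pb n (\<lambda>p q. Lmat tau eta c n a z p q $ i $ j) (\<lambda>p q. Lmat tau eta c n b w p q $ k $ l) p q
    = (\<Sum>d\<in>{1..n}. \<Sum>m\<in>UNIV. of_bool (d = a \<and> m = j) * (?A / c) * ?g d m)
    - (\<Sum>d\<in>{1..n}. \<Sum>m\<in>UNIV. of_bool (d = b \<and> m = l) * (?B / c) * ?f d m)"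
    unfolding pb_def dp_Lmat[OF c] sum_subtractf by (simp only: mult_ac)
  also have "\<dots> = ?A / c * ?g a j - ?B / c * ?f b l"
    unfolding single[OF a] single[OF b] ..
  finally show ?thesis
    using c by (simp add: right_diff_distrib)
qed

text \<open>The second half of the bracket produces the condition \<open>b = cprev n a\<close>,
  whereas the result is expressed through neighbours of \<open>b\<close>.\<close>

lemma cprev_eq_iff_cnext:
  assumes "a \<in> {1..n}" "b \<in> {1..n}"
  shows "b = cprev n a \<longleftrightarrow> a = cnext n b"
  using assms by (auto simp: cprev_def cnext_def)

text \<open>\<open>L2\<close> cancels the inverse in \<open>s21\<close> and leaves the
  \<open>Dmat\<close> term; subtracting \<open>uminus_mat\<close> supplies the \<open>E1\<close>
  term. Together they form the derivative of the \<open>(k, l)\<close> entry in the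
  \<open>j\<close>-th coordinate of the preceding site.\<close>

lemma L2_sminus_nth:
  assumes "invertible (Lmat tau eta c n b w p q)"
  shows "(L2 tau eta c n b w p q ** sminus tau eta c n b w p q) $ (i, k) $ (j, l)
    = of_bool (i = j) * Lmat_dprev tau eta c n b w p q j k l"
proof -
  let ?B = "Lmat tau eta c n b w p q" and ?E = "\<lambda>i l. E1 tau (q (cprev n b) i - q b l + eta)"
  have "(L2 tau eta c n b w p q ** sminus tau eta c n b w p q) $ (i, k) $ (j, l)
    = (\<Sum>m\<in>UNIV. ?B $ k $ m * (matrix_inv ?B $ m $ i * (of_bool (i = j) * Dmat tau eta c n b w p q $ i $ l)))
    + (\<Sum>m\<in>UNIV. ?B $ k $ m * (of_bool (i = j \<and> m = l) * ?E i l))"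
    unfolding L2_def mat1_tens_mult_nth sminus_def
    by (simp add: s21_nth uminus_mat_nth distrib_left sum.distrib mult_ac)
  also have "(\<Sum>m\<in>UNIV. ?B $ k $ m * (of_bool (i = j \<and> m = l) * ?E i l))
      = ?B $ k $ l * (of_bool (i = j \<and> l = l) * ?E i l)"
    by (rule sum_UNIV_single) simp
  finally show ?thesis
    unfolding sum_matrix_inv[OF assms] by (auto simp: Lmat_dprev_def)
qed

lemma L1_splus_nth:
  assumes "invertible (Lmat tau eta c n a z p q)"
  shows "(L1 tau eta c n a z p q ** splus tau eta c n a z p q) $ (i, k) $ (j, l)
    = of_bool (k = l) * Lmat_dprev tau eta c n a z p q l i j"
proof -
  let ?A = "Lmat tau eta c n a z p q" and ?E = "\<lambda>k i. E1 tau (q (cprev n a) k - q a i + eta)"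
  have "(L1 tau eta c n a z p q ** splus tau eta c n a z p q) $ (i, k) $ (j, l)
    = (\<Sum>m\<in>UNIV. ?A $ i $ m * (matrix_inv ?A $ m $ k * (of_bool (k = l) * Dmat tau eta c n a z p q $ k $ j)))
    + (\<Sum>m\<in>UNIV. ?A $ i $ m * (of_bool (m = j \<and> k = l) * ?E k m))"
    unfolding L1_def tens_mat1_mult_nth splus_def
    by (simp add: s12_nth uplus_nth distrib_left sum.distrib mult_ac)
  also have "(\<Sum>m\<in>UNIV. ?A $ i $ m * (of_bool (m = j \<and> k = l) * ?E k m))
      = ?A $ i $ j * (of_bool (j = j \<and> k = l) * ?E k j)"
    by (rule sum_UNIV_single) simp
  finally show ?thesis
    unfolding sum_matrix_inv[OF assms] by (auto simp: Lmat_dprev_def)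
qed

lemma L1_L2_sminus_nth:
  assumes "invertible (Lmat tau eta c n b w p q)"
  shows "(L1 tau eta c n a z p q ** L2 tau eta c n b w p q ** sminus tau eta c n b w p q) $ (i, k) $ (j, l)
    = Lmat tau eta c n a z p q $ i $ j * Lmat_dprev tau eta c n b w p q j k l"
proof -
  let ?A = "Lmat tau eta c n a z p q"
  have "(L1 tau eta c n a z p q ** L2 tau eta c n b w p q ** sminus tau eta c n b w p q) $ (i, k) $ (j, l)
    = (\<Sum>m\<in>UNIV. ?A $ i $ m * (of_bool (m = j) * Lmat_dprev tau eta c n b w p q j k l))"
    unfolding matrix_mul_assoc[symmetric] L1_def tens_mat1_mult_nth L2_sminus_nth[OF assms] ..
  also have "\<dots> = ?A $ i $ j * (of_bool (j = j) * Lmat_dprev tau eta c n b w p q j k l)"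
    by (rule sum_UNIV_single) simp
  finally show ?thesis
    by simp
qed

lemma L1_L2_splus_nth:
  assumes "invertible (Lmat tau eta c n a z p q)"
  shows "(L1 tau eta c n a z p q ** L2 tau eta c n b w p q ** splus tau eta c n a z p q) $ (i, k) $ (j, l)
    = Lmat tau eta c n b w p q $ k $ l * Lmat_dprev tau eta c n a z p q l i j"
proof -
  let ?B = "Lmat tau eta c n b w p q"
  \<comment> \<open>Commuting the two factors puts \<open>L1\<close> next to \<open>splus\<close>,
    where it cancels the inverse.\<close>
  have comm: "L1 tau eta c n a z p q ** L2 tau eta c n b w p q = L2 tau eta c n b w p q ** L1 tau eta c n a z p q"
    by (simp add: L1_def L2_def tens_mat1_mult_mat1_tens mat1_tens_mult_tens_mat1)
  have "(L1 tau eta c n a z p q ** L2 tau eta c n b w p q ** splus tau eta c n a z p q) $ (i, k) $ (j, l)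
    = (\<Sum>m\<in>UNIV. ?B $ k $ m * (of_bool (m = l) * Lmat_dprev tau eta c n a z p q l i j))"
    unfolding comm matrix_mul_assoc[symmetric] unfolding L2_def mat1_tens_mult_nth L1_splus_nth[OF assms] ..
  also have "\<dots> = ?B $ k $ l * (of_bool (l = l) * Lmat_dprev tau eta c n a z p q l i j)"
    by (rule sum_UNIV_single) simp
  finally show ?thesis
    by simp
qed

text \<open>With \<open>L2\<close> on the right, the index of the derivative is the row
  \<open>k\<close> and not the column \<open>l\<close> as in \<open>L1_L2_splus_nth\<close>. Such
  terms are not summands of the bracket; they enter the elliptic identity of
  \<open>site_bracket_nth\<close>.\<close>

lemma L1_splus_L2_nth:
  assumes "invertible (Lmat tau eta c n b z p q)"
  shows "(L1 tau eta c n b z p q ** splus tau eta c n b z p q ** L2 tau eta c n b w p q) $ (i, k) $ (j, l)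
    = Lmat_dprev tau eta c n b z p q k i j * Lmat tau eta c n b w p q $ k $ l"
proof -
  have "(L1 tau eta c n b z p q ** splus tau eta c n b z p q ** L2 tau eta c n b w p q) $ (i, k) $ (j, l)
    = (\<Sum>m\<in>UNIV. of_bool (k = m) * Lmat_dprev tau eta c n b z p q m i j * Lmat tau eta c n b w p q $ m $ l)"
    unfolding L2_def mult_mat1_tens_nth L1_splus_nth[OF assms] ..
  also have "\<dots> = of_bool (k = k) * Lmat_dprev tau eta c n b z p q k i j * Lmat tau eta c n b w p q $ k $ l"
    by (rule sum_UNIV_single) simp
  finally show ?thesis
    by simp
qed

lemma L2_sminus_L1_nth:
  assumes "invertible (Lmat tau eta c n b w p q)"
  shows "(L2 tau eta c n b w p q ** sminus tau eta c n b w p q ** L1 tau eta c n b z p q) $ (i, k) $ (j, l)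
    = Lmat_dprev tau eta c n b w p q i k l * Lmat tau eta c n b z p q $ i $ j"
proof -
  have "(L2 tau eta c n b w p q ** sminus tau eta c n b w p q ** L1 tau eta c n b z p q) $ (i, k) $ (j, l)
    = (\<Sum>m\<in>UNIV. of_bool (i = m) * Lmat_dprev tau eta c n b w p q m k l * Lmat tau eta c n b z p q $ m $ j)"
    unfolding L1_def mult_tens_mat1_nth L2_sminus_nth[OF assms] ..
  also have "\<dots> = of_bool (i = i) * Lmat_dprev tau eta c n b w p q i k l * Lmat tau eta c n b z p q $ i $ j"
    by (rule sum_UNIV_single) simp
  finally show ?thesis
    by simp
qed

section \<open>Products with the r-matrix\<close>

lemma tens_mult_rmat_nth:
  "(tens A B ** rmat tau a q z w) $ (i, k) $ (j, l)
    = A $ i $ l * B $ k $ j * (if j = l then 0 else ellphi tau (z - w) (q a l - q a j))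
    + A $ i $ j * B $ k $ l * (if l = j then E1 tau (z - w) else - E1 tau (q a j - q a l))"
proof -
  have "(\<Sum>i'\<in>UNIV. \<Sum>k'\<in>UNIV. A $ i $ i' * B $ k $ k' *
      (of_bool (i' = l \<and> k' = j) * (if k' = i' then 0 else ellphi tau (z - w) (q a i' - q a k'))))
    = A $ i $ l * B $ k $ j * (of_bool (l = l \<and> j = j) * (if j = l then 0 else ellphi tau (z - w) (q a l - q a j)))"
    by (rule sum_pair_single) auto
  moreover have "(\<Sum>i'\<in>UNIV. \<Sum>k'\<in>UNIV. A $ i $ i' * B $ k $ k' *
      (of_bool (i' = j \<and> k' = l) * (if k' = i' then E1 tau (z - w) else - E1 tau (q a i' - q a k'))))
    = A $ i $ j * B $ k $ l * (of_bool (j = j \<and> l = l) * (if l = j then E1 tau (z - w) else - E1 tau (q a j - q a l)))"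
    by (rule sum_pair_single) auto
  ultimately show ?thesis
    unfolding tens_mult_nth rmat_nth distrib_left sum.distrib by simp
qed

text \<open>From the left the permutation part exchanges the rows \<open>i\<close> and
  \<open>k\<close>; from the right, in \<open>tens_mult_rmat_nth\<close>, it exchanges the columns
  \<open>j\<close> and \<open>l\<close>.\<close>

lemma rmat_mult_tens_nth:
  "(rmat tau a q z w ** tens A B) $ (i, k) $ (j, l)
    = (if k = i then 0 else ellphi tau (z - w) (q a i - q a k)) * (A $ k $ j * B $ i $ l)
    + (if k = i then E1 tau (z - w) else - E1 tau (q a i - q a k)) * (A $ i $ j * B $ k $ l)"
proof -
  have "(\<Sum>j'\<in>UNIV. \<Sum>l'\<in>UNIV. of_bool (i = l' \<and> k = j')
      * (if k = i then 0 else ellphi tau (z - w) (q a i - q a k)) * (A $ j' $ j * B $ l' $ l))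
    = of_bool (i = i \<and> k = k) * (if k = i then 0 else ellphi tau (z - w) (q a i - q a k)) * (A $ k $ j * B $ i $ l)"
    by (rule sum_pair_single) auto
  moreover have "(\<Sum>j'\<in>UNIV. \<Sum>l'\<in>UNIV. of_bool (i = j' \<and> k = l')
      * (if k = i then E1 tau (z - w) else - E1 tau (q a i - q a k)) * (A $ j' $ j * B $ l' $ l))
    = of_bool (i = i \<and> k = k) * (if k = i then E1 tau (z - w) else - E1 tau (q a i - q a k)) * (A $ i $ j * B $ k $ l)"
    by (rule sum_pair_single) auto
  ultimately show ?thesis
    unfolding mult_tens_nth rmat_nth distrib_right sum.distrib by simp
qed

section \<open>The bracket at a single site\<close>

lemma cprev_mem: "b \<in> {1..n} \<Longrightarrow> cprev n b \<in> {1..n}"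
  by (auto simp: cprev_def)

lemma site_bracket_nth:
  fixes q :: "'N::finite coords"
  assumes tau: "Im tau > 0"
    and zw: "jtheta tau (z - w) \<noteq> 0"
    and u_nz: "\<And>i j. jtheta tau (q (cprev n b) i - q b j + eta) \<noteq> 0"
    and z_nz: "\<And>i j. jtheta tau (z + q (cprev n b) i - q b j + eta) \<noteq> 0"
    and w_nz: "\<And>i j. jtheta tau (w + q (cprev n b) i - q b j + eta) \<noteq> 0"
    and x_nz: "\<And>i j. i \<noteq> j \<Longrightarrow> jtheta tau (q (cprev n b) i - q (cprev n b) j) \<noteq> 0"
    and y_nz: "\<And>i j. i \<noteq> j \<Longrightarrow> jtheta tau (q b i - q b j) \<noteq> 0"
    and inv: "invertible (Lmat tau eta c n b z p q)" "invertible (Lmat tau eta c n b w p q)"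
  shows "(L1 tau eta c n b z p q ** L2 tau eta c n b w p q ** rmat tau b q z w
        - rmat tau (cprev n b) q z w ** L1 tau eta c n b z p q ** L2 tau eta c n b w p q
        + L1 tau eta c n b z p q ** splus tau eta c n b z p q ** L2 tau eta c n b w p q
        - L2 tau eta c n b w p q ** sminus tau eta c n b w p q ** L1 tau eta c n b z p q) $ (i, k) $ (j, l)
    = Lmat tau eta c n b z p q $ i $ j * Lmat_dsite tau eta c n b w p q j k l
    - Lmat tau eta c n b w p q $ k $ l * Lmat_dsite tau eta c n b z p q l i j"
proof -
  let ?x = "q (cprev n b)" and ?y = "q b"
  let ?E = "E1 tau" and ?phi = "ellphi tau"
  define A B where "A = Lmat tau eta c n b z p q" and "B = Lmat tau eta c n b w p q"
  define u where "u i j = ?x i - ?y j + eta" for i j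
  \<comment> \<open>\<open>G\<close> depends on the column only. Exchanging rows or columns keeps
    the factor \<open>G j * G l\<close>, so every term of the identity carries it and only
    \<open>ellphi\<close> and \<open>E1\<close> remain.\<close>
  define G where "G j = (\<Prod>l\<in>UNIV. jtheta tau (?y j - ?x l - eta))
      / (jtheta tau (- eta) * (\<Prod>l\<in>UNIV - {j}. jtheta tau (?y j - ?y l))) * exp (p b j / c)" for j
  \<comment> \<open>This part is independent of the spectral parameter and the row; it appears only
    for \<open>j = l\<close> and cancels in the antisymmetric difference.\<close>
  define S where "S j = (\<Sum>l\<in>UNIV. ?E (?y j - ?x l - eta)) - (\<Sum>l\<in>UNIV - {j}. ?E (?y j - ?y l))" for j
  have A: "A $ i $ j = ?phi z (u i j) * G j" and B: "B $ i $ j = ?phi w (u i j) * G j" for i j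
    by (simp_all add: A_def B_def Lmat_def u_def G_def)
  have zu: "z + ?x i - ?y j + eta = z + u i j" and wu: "w + ?x i - ?y j + eta = w + u i j" for i j
    by (simp_all add: u_def)
  have DA: "Dmat tau eta c n b z p q $ i $ j = A $ i $ j * (?E (z + u i j) - ?E (u i j))"
    and DB: "Dmat tau eta c n b w p q $ i $ j = B $ i $ j * (?E (w + u i j) - ?E (u i j))" for i j
    unfolding zu[symmetric] wu[symmetric] by (simp_all add: A_def B_def Dmat_def u_def)
  have siteA: "Lmat_dsite tau eta c n b z p q m i j
      = (if m = j then A $ i $ j * S j - A $ i $ j * (?E (z + u i j) - ?E (u i j)) else A $ i $ j * ?E (?y j - ?y m))"
    and siteB: "Lmat_dsite tau eta c n b w p q m i j
      = (if m = j then B $ i $ j * S j - B $ i $ j * (?E (w + u i j) - ?E (u i j)) else B $ i $ j * ?E (?y j - ?y m))"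
    for m i j
    unfolding Lmat_dsite_def DA DB by (simp_all add: A_def B_def S_def)
  have prevA: "Lmat_dprev tau eta c n b z p q m i j
      = of_bool (m = i) * (A $ i $ j * (?E (z + u i j) - ?E (u i j))) + A $ i $ j * ?E (u m j)"
    and prevB: "Lmat_dprev tau eta c n b w p q m i j
      = of_bool (m = i) * (B $ i $ j * (?E (w + u i j) - ?E (u i j))) + B $ i $ j * ?E (u m j)"
    for m i j
    unfolding Lmat_dprev_def DA DB by (simp_all add: A_def B_def u_def)
  have unz: "jtheta tau (u i j) \<noteq> 0" "jtheta tau (z + u i j) \<noteq> 0" "jtheta tau (w + u i j) \<noteq> 0" for i j
    using u_nz z_nz w_nz unfolding zu wu by (simp_all add: u_def)
  have *: "A $ i $ l * B $ k $ j * (if j = l then 0 else ?phi (z - w) (?y l - ?y j))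
      + A $ i $ j * B $ k $ l * (if l = j then ?E (z - w) else - ?E (?y j - ?y l))
      - ((if k = i then 0 else ?phi (z - w) (?x i - ?x k)) * (A $ k $ j * B $ i $ l)
        + (if k = i then ?E (z - w) else - ?E (?x i - ?x k)) * (A $ i $ j * B $ k $ l))
      + (of_bool (k = i) * (A $ i $ j * (?E (z + u i j) - ?E (u i j))) + A $ i $ j * ?E (u k j)) * B $ k $ l
      - (of_bool (i = k) * (B $ k $ l * (?E (w + u k l) - ?E (u k l))) + B $ k $ l * ?E (u i l)) * A $ i $ j
    = A $ i $ j * (if j = l then B $ k $ l * S l - B $ k $ l * (?E (w + u k l) - ?E (u k l)) else B $ k $ l * ?E (?y l - ?y j))
      - B $ k $ l * (if l = j then A $ i $ j * S j - A $ i $ j * (?E (z + u i j) - ?E (u i j)) else A $ i $ j * ?E (?y j - ?y l))"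
  proof (cases "i = k"; cases "j = l")
    assume ik: "i = k" and jl: "j = l"
    show ?thesis
      \<comment> \<open>The two \<open>E1 tau (z - w)\<close> terms cancel, as do those of
        \<open>S\<close>, and both sides reduce to
        \<open>A * B * (E1 (z + u) - E1 (w + u))\<close>.\<close>
      unfolding ik[symmetric] jl[symmetric] if_True refl[THEN eqTrueI] of_bool_eq by algebra
  next
    assume ik: "i \<noteq> k" and jl: "j = l"
    \<comment> \<open>In a common column the site coordinate drops out of the difference, so only
      the preceding site's r-matrix has an off-diagonal term.\<close>
    have eqs: "u i j - u k j = ?x i - ?x k"
      by (simp add: u_def)
    have id: "?phi z (u i j) * ?phi w (u k j) * (?E (z - w) + ?E (?x i - ?x k) + ?E (w + u k j) - ?E (z + u i j))
        = ?phi (z - w) (?x i - ?x k) * ?phi z (u k j) * ?phi w (u i j)"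
      using ellphi_mult_E1[OF tau zw, of "u i j" "u k j", unfolded eqs] unz x_nz[OF ik] by blast
    have if_simps: "(if k = i then s else t) = t" "of_bool (k = i) = (0 :: complex)" "of_bool (i = k) = (0 :: complex)"
      for s t :: complex
      using ik by auto
    show ?thesis
      unfolding if_simps jl[symmetric] if_True refl[THEN eqTrueI] A B using id by algebra
  next
    assume ik: "i = k" and jl: "j \<noteq> l"
    have eqs: "u i j - u i l = ?y l - ?y j"
      by (simp add: u_def)
    have id: "?phi z (u i j) * ?phi w (u i l) * (?E (z - w) + ?E (?y l - ?y j) + ?E (w + u i l) - ?E (z + u i j))
        = ?phi (z - w) (?y l - ?y j) * ?phi z (u i l) * ?phi w (u i j)"
      using ellphi_mult_E1[OF tau zw, of "u i j" "u i l", unfolded eqs] unz y_nz[of l j] jl by blast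
    have if_simps: "(if j = l then s else t) = t" "(if l = j then s else t) = t" for s t :: complex
      using jl by auto
    have odd: "?E (?y j - ?y l) = - ?E (?y l - ?y j)"
      using E1_minus[OF tau, of "?y l - ?y j"] by simp
    show ?thesis
      unfolding if_simps ik[symmetric] if_True refl[THEN eqTrueI] of_bool_eq A B odd using id by algebra
  next
    assume ik: "i \<noteq> k" and jl: "j \<noteq> l"
    \<comment> \<open>The choice of \<open>A\<close>, \<open>B\<close>, \<open>C\<close> that yields
      all four entries \<open>u\<close> at once; the two products on the right are the permutation
      terms of the two r-matrices.\<close>
    have eqs: "(?y l - ?y j) + u i l = u i j" "(?x k - ?x i) + u i l = u k l"
        "(?y l - ?y j) + (?x k - ?x i) + u i l = u k j" "- (?x k - ?x i) = ?x i - ?x k"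
      by (simp_all add: u_def)
    have odd: "?E (?y j - ?y l) = - ?E (?y l - ?y j)" "?E (?x k - ?x i) = - ?E (?x i - ?x k)"
      using E1_minus[OF tau, of "?y l - ?y j"] E1_minus[OF tau, of "?x i - ?x k"] by simp_all
    have id: "?phi z (u i j) * ?phi w (u k l) * (?E (?y l - ?y j) + - ?E (?x i - ?x k) + ?E (u i l) - ?E (u k j))
        = ?phi (z - w) (?y l - ?y j) * ?phi z (u i l) * ?phi w (u k j)
        - ?phi (z - w) (?x i - ?x k) * ?phi z (u k j) * ?phi w (u i l)"
      using ellphi_mult_E1'[OF tau zw, of "?y l - ?y j" "?x k - ?x i" "u i l", unfolded eqs odd]
        unz y_nz[of l j] x_nz[of k i] ik jl by blast
    have if_simps: "(if j = l then s else t) = t" "(if l = j then s else t) = t" "(if k = i then s else t) = t"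
      "of_bool (k = i) = (0 :: complex)" "of_bool (i = k) = (0 :: complex)" for s t :: complex
      using ik jl by auto
    show ?thesis
      unfolding if_simps A B odd using id by algebra
  qed
  have LL: "L1 tau eta c n b z p q ** L2 tau eta c n b w p q = tens A B"
    by (simp add: L1_def L2_def tens_mat1_mult_mat1_tens A_def B_def)
  show ?thesis
    unfolding vector_add_component vector_minus_component L1_splus_L2_nth[OF inv(1)] L2_sminus_L1_nth[OF inv(2)]
    unfolding matrix_mul_assoc[symmetric, of "rmat tau (cprev n b) q z w"] LL
      tens_mult_rmat_nth rmat_mult_tens_nth siteA siteB prevA prevB
    unfolding A_def[symmetric] B_def[symmetric] by (rule *)
qed

theorem theorem1:
  fixes tau eta c z w :: complex and n a b :: nat and p q :: "nat \<Rightarrow> 'N::finite \<Rightarrow> complex"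
  assumes "Im tau > 0" and "c \<noteq> 0" and "n \<ge> 1" and "a \<in> {1..n}" and "b \<in> {1..n}"
    and "jtheta tau (- eta) \<noteq> 0"
    and "jtheta tau z \<noteq> 0" and "jtheta tau w \<noteq> 0" and "jtheta tau (z - w) \<noteq> 0"
    and "\<forall>d\<in>{1..n}. \<forall>i j. jtheta tau (q (cprev n d) i - q d j + eta) \<noteq> 0"
    and "\<forall>d\<in>{1..n}. \<forall>i j. i \<noteq> j \<longrightarrow> jtheta tau (q d i - q d j) \<noteq> 0"
    and "\<forall>d\<in>{1..n}. \<forall>i j. jtheta tau (z + q (cprev n d) i - q d j + eta) \<noteq> 0
                          \<and> jtheta tau (w + q (cprev n d) i - q d j + eta) \<noteq> 0"
    and "\<forall>d\<in>{1..n}. invertible (Lmat tau eta c n d z p q) \<and> invertible (Lmat tau eta c n d w p q)"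
  shows "smat c (pbm n (\<lambda>p q. Lmat tau eta c n a z p q) (\<lambda>p q. Lmat tau eta c n b w p q) p q) =
      (if a = b then
          L1 tau eta c n b z p q ** L2 tau eta c n b w p q ** rmat tau b q z w
        - rmat tau (cprev n b) q z w ** L1 tau eta c n b z p q ** L2 tau eta c n b w p q
        + L1 tau eta c n b z p q ** splus tau eta c n b z p q ** L2 tau eta c n b w p q
        - L2 tau eta c n b w p q ** sminus tau eta c n b w p q ** L1 tau eta c n b z p q
       else 0)
    + (if a = cprev n b then
          L1 tau eta c n (cprev n b) z p q ** L2 tau eta c n b w p q ** sminus tau eta c n b w p q
       else 0)
    - (if a = cnext n b then
          L1 tau eta c n (cnext n b) z p q ** L2 tau eta c n b w p q ** splus tau eta c n (cnext n b) z p q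
       else 0)"
    (is "?lhs = (if a = b then ?site else 0) + (if a = cprev n b then ?prev else 0) - (if a = cnext n b then ?next else 0)")
proof -
  let ?A = "Lmat tau eta c n a z p q" and ?B = "Lmat tau eta c n b w p q"
  note ab = assms(4,5)
  have pb: "cprev n b \<in> {1..n}"
    using assms(5) by (rule cprev_mem)
  have if_nth: "(if P then M else 0) $ x $ y = (if P then M $ x $ y else 0)"
    for P and M :: "complex^('N \<times> 'N)^('N \<times> 'N)" and x y
    by simp
  have "?lhs $ (i, k) $ (j, l)
      = ((if a = b then ?site else 0) + (if a = cprev n b then ?prev else 0)
        - (if a = cnext n b then ?next else 0)) $ (i, k) $ (j, l)" for i j k l
  proof -
    have dqA: "dq b l (\<lambda>p q. Lmat tau eta c n a z p q $ i $ j) p q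
        = of_bool (b = a) * Lmat_dsite tau eta c n a z p q l i j
        + of_bool (b = cprev n a) * Lmat_dprev tau eta c n a z p q l i j"
      using assms ab by (intro dq_Lmat) auto
    have dqB: "dq a j (\<lambda>p q. Lmat tau eta c n b w p q $ k $ l) p q
        = of_bool (a = b) * Lmat_dsite tau eta c n b w p q j k l
        + of_bool (a = cprev n b) * Lmat_dprev tau eta c n b w p q j k l"
      using assms ab by (intro dq_Lmat) auto
    have site: "?site $ (i, k) $ (j, l)
        = Lmat tau eta c n b z p q $ i $ j * Lmat_dsite tau eta c n b w p q j k l
        - ?B $ k $ l * Lmat_dsite tau eta c n b z p q l i j"
      using assms pb by (intro site_bracket_nth) auto
    have prev: "?prev $ (i, k) $ (j, l)
        = Lmat tau eta c n (cprev n b) z p q $ i $ j * Lmat_dprev tau eta c n b w p q j k l"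
      using assms by (intro L1_L2_sminus_nth) auto
    \<comment> \<open>Under this condition the site can be renamed to \<open>a\<close>, which is
      known to lie in the range where invertibility is assumed.\<close>
    have "next": "?next $ (i, k) $ (j, l) = ?B $ k $ l * Lmat_dprev tau eta c n a z p q l i j" if "a = cnext n b"
      unfolding that[symmetric] using assms by (intro L1_L2_splus_nth) auto
    have "?lhs $ (i, k) $ (j, l)
      = ?A $ i $ j * (of_bool (a = b) * Lmat_dsite tau eta c n b w p q j k l
        + of_bool (a = cprev n b) * Lmat_dprev tau eta c n b w p q j k l)
      - ?B $ k $ l * (of_bool (b = a) * Lmat_dsite tau eta c n a z p q l i j
        + of_bool (a = cnext n b) * Lmat_dprev tau eta c n a z p q l i j)"
      using pb_Lmat[OF assms(2) ab, of tau eta z i j w k l p q]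
      unfolding dqA dqB cprev_eq_iff_cnext[OF ab] by (simp add: smat_def pbm_def)
    \<comment> \<open>The three contributions are added and not treated as alternatives: for
      \<open>n = 1\<close> all three conditions hold at once, and for \<open>n = 2\<close> the
      previous and next sites coincide.\<close>
    also have "\<dots> = (if a = b then ?A $ i $ j * Lmat_dsite tau eta c n b w p q j k l
          - ?B $ k $ l * Lmat_dsite tau eta c n a z p q l i j else 0)
        + (if a = cprev n b then ?A $ i $ j * Lmat_dprev tau eta c n b w p q j k l else 0)
        - (if a = cnext n b then ?B $ k $ l * Lmat_dprev tau eta c n a z p q l i j else 0)"
      by (auto simp: algebra_simps)
    also have "\<dots> = (if a = b then ?site $ (i, k) $ (j, l) else 0) + (if a = cprev n b then ?prev $ (i, k) $ (j, l) else 0)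
        - (if a = cnext n b then ?next $ (i, k) $ (j, l) else 0)"
      unfolding site prev using "next" by (intro arg_cong2[of _ _ _ _ "(+)"] arg_cong2[of _ _ _ _ "(-)"] if_cong refl) auto
    finally show ?thesis
      unfolding vector_add_component vector_minus_component if_nth .
  qed
  thus ?thesis
    by (simp add: vec_eq_iff)
qed

end
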